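(* Fix $1<\alpha<\beta$, let $I_1=[0,1]$, $I_2=[\alpha,\beta]$, let $\phi,\psi,\theta\in\mathbb{R}$, and let $P_B$ be the selfadjoint restriction of the maximal momentum operator associated with the matrix $B=B(w,\phi,\psi,\theta)$ with $w=0$. Then $P_B$ has pure point spectrum $$\frac{\frac12-\theta}{1+\beta-\alpha}+\frac{1}{1+\beta-\alpha}\mathbb{Z}$$ with uniform multiplicity equal to one, and an eigenfunction corresponding to the eigenvalue $\frac{\frac12-\theta+n}{1+\beta-\alpha}$, $n\in\mathbb{Z}$, is $$\left(e\left(\tfrac12-\psi+\frac{\left(\frac12+n\right)\beta+(1-\alpha)\theta}{1+\beta-\alpha}\right)\chi_{I_1}+\chi_{I_2}\right)e_{\frac{\frac12-\theta+n}{1+\beta-\alpha}}.$$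
   Context: $e(x):=e^{i2\pi x}$ and $e_x(y):=e(xy)$; $\chi_S$ is the indicator function of $S$. The maximal momentum operator is $P=\frac{1}{i2\pi}\frac{d}{dt}$ on $L^2(I_1\cup I_2)$, with domain $\mathscr{D}(P)$ the absolutely continuous functions $f$ on $I_1\cup I_2$ with $f'\in L^2(I_1\cup I_2)$. For $0\le w\le 1$ and $\phi,\psi,\theta\in\mathbb{R}$, $$B=B(w,\phi,\psi,\theta)=\begin{pmatrix} w\,e(\phi) & -\sqrt{1-w^2}\,e(\theta-\psi)\\ \sqrt{1-w^2}\,e(\psi) & w\,e(\theta-\phi)\end{pmatrix},$$ and $P_B$ is the restriction of $P$ to $\mathscr{D}(P_B)=\{f\in\mathscr{D}(P) : B\,(f(1),f(\beta))^T=(f(0),f(\alpha))^T\}$. *)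

theory Defs
  imports "HOL-Analysis.Analysis"
begin

section \<open>Square-integrable functions and unbounded operators\<close>

text \<open>Elements of the Hilbert space \<open>L\<^sup>2(M)\<close> are represented by functions; all notions below
  compare functions almost everywhere, i.e. as elements of \<open>L\<^sup>2(M)\<close>.\<close>

definition L2_space :: "'a measure \<Rightarrow> ('a \<Rightarrow> complex) set" where
  "L2_space M = {f \<in> borel_measurable M. integrable M (\<lambda>x. (norm (f x))\<^sup>2)}"

definition L2_norm :: "'a measure \<Rightarrow> ('a \<Rightarrow> complex) \<Rightarrow> real" where
  "L2_norm M f = sqrt (\<integral>x. (norm (f x))\<^sup>2 \<partial>M)"

text \<open>An unbounded operator is a pair of its domain and its action. The domain may consist of
  distinguished representatives of its \<open>L\<^sup>2\<close>-classes (for a differential operator: the absolutely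
  continuous ones).\<close>

type_synonym 'a l2_operator = "('a \<Rightarrow> complex) set \<times> (('a \<Rightarrow> complex) \<Rightarrow> 'a \<Rightarrow> complex)"

definition restrict_operator :: "'a l2_operator \<Rightarrow> (('a \<Rightarrow> complex) \<Rightarrow> bool) \<Rightarrow> 'a l2_operator" where
  "restrict_operator T Q = ({f \<in> fst T. Q f}, snd T)"

text \<open>\<open>z\<close> is in the resolvent set iff \<open>T - z\<close> is a bijection of the domain onto \<open>L\<^sup>2(M)\<close> with
  bounded inverse. The lower bound expresses injectivity together with boundedness of the
  inverse.\<close>

definition resolvent_set :: "'a measure \<Rightarrow> 'a l2_operator \<Rightarrow> complex set" where
  "resolvent_set M T = {z.
     (\<exists>C. \<forall>f\<in>fst T. L2_norm M f \<le> C * L2_norm M (\<lambda>x. snd T f x - z * f x)) \<and>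
     (\<forall>h\<in>L2_space M. \<exists>f\<in>fst T. AE x in M. snd T f x - z * f x = h x)}"

definition operator_spectrum :: "'a measure \<Rightarrow> 'a l2_operator \<Rightarrow> complex set" where
  "operator_spectrum M T = - resolvent_set M T"

definition eigenspace :: "'a measure \<Rightarrow> 'a l2_operator \<Rightarrow> complex \<Rightarrow> ('a \<Rightarrow> complex) set" where
  "eigenspace M T z = {f \<in> fst T. AE x in M. snd T f x = z * f x}"

definition is_eigenfunction ::
    "'a measure \<Rightarrow> 'a l2_operator \<Rightarrow> complex \<Rightarrow> ('a \<Rightarrow> complex) \<Rightarrow> bool" where
  "is_eigenfunction M T z f \<longleftrightarrow> f \<in> eigenspace M T z \<and> \<not> (AE x in M. f x = 0)"

definition point_spectrum :: "'a measure \<Rightarrow> 'a l2_operator \<Rightarrow> complex set" where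
  "point_spectrum M T = {z. \<exists>f. is_eigenfunction M T z f}"

text \<open>The eigenspace, as a subspace of \<open>L\<^sup>2(M)\<close>, has a basis of \<open>n\<close> elements.\<close>

definition has_eigenvalue_multiplicity ::
    "'a measure \<Rightarrow> 'a l2_operator \<Rightarrow> complex \<Rightarrow> nat \<Rightarrow> bool" where
  "has_eigenvalue_multiplicity M T z n \<longleftrightarrow>
     (\<exists>b :: nat \<Rightarrow> 'a \<Rightarrow> complex.
        (\<forall>i<n. b i \<in> eigenspace M T z) \<and>
        (\<forall>c :: nat \<Rightarrow> complex. (AE x in M. (\<Sum>i<n. c i * b i x) = 0) \<longrightarrow> (\<forall>i<n. c i = 0)) \<and>
        (\<forall>f\<in>eigenspace M T z. \<exists>c :: nat \<Rightarrow> complex. AE x in M. f x = (\<Sum>i<n. c i * b i x)))"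

text \<open>The linear span of the eigenfunctions is dense in \<open>L\<^sup>2(M)\<close>.\<close>

definition eigenfunctions_total :: "'a measure \<Rightarrow> 'a l2_operator \<Rightarrow> bool" where
  "eigenfunctions_total M T \<longleftrightarrow>
     (\<forall>h\<in>L2_space M. \<forall>\<epsilon>>0. \<exists>F c. finite F \<and> (\<forall>f\<in>F. \<exists>z. is_eigenfunction M T z f) \<and>
        L2_norm M (\<lambda>x. h x - (\<Sum>f\<in>F. c f * f x)) < \<epsilon>)"

text \<open>For a selfadjoint operator, totality of the eigenfunctions says that all spectral measures
  are pure point, and the spectrum is then the closure of the set of eigenvalues; here every point of the spectrum is also required to be an eigenvalue.\<close>

definition has_pure_point_spectrum ::
    "'a measure \<Rightarrow> 'a l2_operator \<Rightarrow> complex set \<Rightarrow> bool" where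
  "has_pure_point_spectrum M T \<Lambda> \<longleftrightarrow>
     operator_spectrum M T = \<Lambda> \<and> point_spectrum M T = \<Lambda> \<and> eigenfunctions_total M T"


section \<open>The momentum operator on two intervals\<close>

text \<open>The usual \<open>\<epsilon>\<close>-\<open>\<delta>\<close> definition; a division of a subset of the interval is a finite family of
  non-overlapping compact intervals \<open>k = {Inf k..Sup k}\<close>.\<close>

definition absolutely_continuous_fun_on :: "(real \<Rightarrow> complex) \<Rightarrow> real set \<Rightarrow> bool" where
  "absolutely_continuous_fun_on f I \<longleftrightarrow>
     (\<forall>\<epsilon>>0. \<exists>\<delta>>0. \<forall>d t. d division_of t \<and> t \<subseteq> I \<and> (\<Sum>k\<in>d. Sup k - Inf k) < \<delta> \<longrightarrow>
        (\<Sum>k\<in>d. norm (f (Sup k) - f (Inf k))) < \<epsilon>)"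

definition two_intervals :: "real \<Rightarrow> real \<Rightarrow> real set" where
  "two_intervals \<alpha> \<beta> = {0..1} \<union> {\<alpha>..\<beta>}"

definition interval_deriv :: "real \<Rightarrow> real \<Rightarrow> (real \<Rightarrow> complex) \<Rightarrow> real \<Rightarrow> complex" where
  "interval_deriv \<alpha> \<beta> f x = vector_derivative f (at x within two_intervals \<alpha> \<beta>)"

text \<open>Almost everywhere differentiability, which is automatic for absolutely continuous functions,
  is stated because \<^const>\<open>vector_derivative\<close> is unspecified where there is no derivative.\<close>

definition max_momentum_dom :: "real \<Rightarrow> real \<Rightarrow> (real \<Rightarrow> complex) set" where
  "max_momentum_dom \<alpha> \<beta> = {f.
     absolutely_continuous_fun_on f {0..1} \<and> absolutely_continuous_fun_on f {\<alpha>..\<beta>} \<and>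
     (AE x in lebesgue_on (two_intervals \<alpha> \<beta>).
        f differentiable (at x within two_intervals \<alpha> \<beta>)) \<and>
     interval_deriv \<alpha> \<beta> f \<in> L2_space (lebesgue_on (two_intervals \<alpha> \<beta>))}"

definition max_momentum :: "real \<Rightarrow> real \<Rightarrow> real l2_operator" where
  "max_momentum \<alpha> \<beta> =
     (max_momentum_dom \<alpha> \<beta>, \<lambda>f x. 1 / (\<i> * 2 * of_real pi) * interval_deriv \<alpha> \<beta> f x)"

definition e_fun :: "real \<Rightarrow> complex" where
  "e_fun x = exp (\<i> * 2 * of_real pi * of_real x)"

definition boundary_matrix :: "real \<Rightarrow> real \<Rightarrow> real \<Rightarrow> real \<Rightarrow> complex^2^2" where
  "boundary_matrix w \<phi> \<psi> \<theta> = vector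
     [vector [of_real w * e_fun \<phi>, - of_real (sqrt (1 - w\<^sup>2)) * e_fun (\<theta> - \<psi>)],
      vector [of_real (sqrt (1 - w\<^sup>2)) * e_fun \<psi>, of_real w * e_fun (\<theta> - \<phi>)]]"

definition momentum_restriction :: "real \<Rightarrow> real \<Rightarrow> complex^2^2 \<Rightarrow> real l2_operator" where
  "momentum_restriction \<alpha> \<beta> B = restrict_operator (max_momentum \<alpha> \<beta>)
     (\<lambda>f. B *v vector [f 1, f \<beta>] = vector [f 0, f \<alpha>])"

end

theory Submission
  imports Defs
begin

text \<open>For \<open>w = 0\<close> the boundary condition decouples into \<open>f \<alpha> = e(\<psi>) f 1\<close> and
\<open>f 0 = - e(\<theta> - \<psi>) f \<beta>\<close>: the right end of the first interval is joined to the left end of the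
second one, and the right end of the second one is joined back to \<open>0\<close>. So the two intervals are
glued to a circle of length \<open>1 + \<beta> - \<alpha>\<close>, and \<open>P\<^sub>B\<close> is the momentum operator on that circle with
total phase \<open>- e(\<theta>)\<close> collected in one turn. Everything follows from that picture.

\<^item> Resolvent set. The equation \<open>P f - z f = g\<close> is the linear equation \<open>f' = \<kappa> f + 2 \<pi> \<i> g\<close> with
  \<open>\<kappa> = 2 \<pi> \<i> z\<close>, and variation of constants determines \<open>f\<close> from \<open>f 0\<close> and \<open>g\<close>. Following a
  solution once around the circle multiplies \<open>f 0\<close> by \<open>- e(\<theta>) exp (\<kappa> (1 + \<beta> - \<alpha>))\<close> and adds a term
  that is controlled by \<open>g\<close>. If \<open>1 + e(\<theta>) exp (\<kappa> (1 + \<beta> - \<alpha>))\<close> is not zero, the closing condition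
  has exactly one solution \<open>f 0\<close>, which depends boundedly on \<open>g\<close>; so \<open>z\<close> is in the resolvent set
  (\<open>resolvent_lower_bound\<close>, \<open>resolvent_surjective\<close>).
  The zeros of this function of \<open>z\<close> are exactly the points of \<open>\<Lambda>\<close>.

\<^item> Eigenvalues. For \<open>z\<close> in \<open>\<Lambda>\<close> the homogeneous solution closes up, which gives the stated
  eigenfunction. An eigenfunction is determined by \<open>f 0\<close>, so the multiplicity is one. A point of
  \<open>\<Lambda>\<close> cannot be in the resolvent set because an eigenfunction violates the lower bound.

\<^item> Totality. Let \<open>p\<close> map the two intervals onto the unit circle according to the gluing. Up to
  constants the \<open>n\<close>-th eigenfunction is the \<open>0\<close>-th one times \<open>p\<^sup>n\<close>, and the \<open>0\<close>-th one has modulus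
  one. So it suffices that the powers \<open>p\<^sup>n\<close> are total in \<open>L\<^sup>2\<close>. Continuous functions that vanish at
  the four endpoints are dense in \<open>L\<^sup>2\<close> (\<open>continuous_vanishing_dense_L2\<close>); they factor through \<open>p\<close>, and by the Stone-Weierstrass
  theorem a continuous function on the circle is a uniform limit of Laurent polynomials
  (\<open>Laurent_polynomials_dense_pullback\<close>).

The domain of the operator consists of absolutely continuous functions in the
\<open>\<epsilon>\<close>-\<open>\<delta>\<close> sense, and variation of constants needs two facts about them:
\<open>has_integral_derivative_of_absolutely_continuous\<close> recovers such a function from its
almost everywhere derivative, and, conversely, the indefinite integral of an integrable function
is absolutely continuous and has the integrand as its derivative almost everywhere
(\<open>absolutely_continuous_indefinite_integral\<close>, \<open>has_vector_derivative_indefinite_integral_ae\<close>).\<close>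

section \<open>Absolutely continuous functions\<close>

text \<open>The definition in a form whose \<open>\<delta>\<close> can be applied to a division by forward reasoning.\<close>
lemma absolutely_continuousE:
  assumes "absolutely_continuous_fun_on f I" "\<epsilon> > 0"
  obtains \<delta> where "\<delta> > 0" "\<And>d t. d division_of t \<Longrightarrow> t \<subseteq> I \<Longrightarrow> (\<Sum>k\<in>d. Sup k - Inf k) < \<delta> \<Longrightarrow>
      (\<Sum>k\<in>d. norm (f (Sup k) - f (Inf k))) < \<epsilon>"
proof -
  obtain \<delta> where \<delta>: "\<delta> > 0 \<and> (\<forall>d t. d division_of t \<and> t \<subseteq> I \<and> (\<Sum>k\<in>d. Sup k - Inf k) < \<delta> \<longrightarrow>
      (\<Sum>k\<in>d. norm (f (Sup k) - f (Inf k))) < \<epsilon>)"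
    using assms(1)[unfolded absolutely_continuous_fun_on_def, THEN spec, THEN mp, OF assms(2)]
    by (rule exE)
  show thesis
  proof (rule that)
    show "\<delta> > 0" using \<delta> by (rule conjunct1)
    show "(\<Sum>k\<in>d. norm (f (Sup k) - f (Inf k))) < \<epsilon>"
      if "d division_of t" "t \<subseteq> I" "(\<Sum>k\<in>d. Sup k - Inf k) < \<delta>" for d t
      using \<delta>[THEN conjunct2, THEN spec, THEN spec, THEN mp, OF conjI[OF that(1) conjI[OF that(2,3)]]] .
  qed
qed

lemma absolutely_continuous_imp_continuous_on:
  assumes "absolutely_continuous_fun_on f {a..b}"
  shows "continuous_on {a..b} f"
  unfolding continuous_on_iff
proof (intro ballI allI impI)
  fix x and \<epsilon> :: real assume x: "x \<in> {a..b}" and "\<epsilon> > 0"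
  then obtain \<delta> where "\<delta> > 0" and \<delta>: "\<And>d t. d division_of t \<Longrightarrow> t \<subseteq> {a..b} \<Longrightarrow>
      (\<Sum>k\<in>d. Sup k - Inf k) < \<delta> \<Longrightarrow> (\<Sum>k\<in>d. norm (f (Sup k) - f (Inf k))) < \<epsilon>"
    using absolutely_continuousE[OF assms \<open>\<epsilon> > 0\<close>] by blast
  have "dist (f y) (f x) < \<epsilon>" if y: "y \<in> {a..b}" "dist y x < \<delta>" for y
  proof -
    define u v where "u = min x y" and "v = max x y"
    have uv: "u \<le> v" "{u..v} \<subseteq> {a..b}" "v - u < \<delta>"
      using x y by (auto simp: u_def v_def dist_real_def)
    have "{{u..v}} division_of {u..v}"
      using division_of_self[of u v] uv(1) by simp
    from \<delta>[OF this] uv have "norm (f v - f u) < \<epsilon>" by simp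
    then show ?thesis
      by (auto simp: u_def v_def dist_norm min_def max_def norm_minus_commute split: if_splits)
  qed
  with \<open>\<delta> > 0\<close> show "\<exists>\<delta>>0. \<forall>y\<in>{a..b}. dist y x < \<delta> \<longrightarrow> dist (f y) (f x) < \<epsilon>" by blast
qed

lemma division_endpoints:
  assumes d: "d division_of t" "t \<subseteq> {a..b::real}" and k: "k \<in> d"
  shows "Inf k \<le> Sup k" "Inf k \<in> {a..b}" "Sup k \<in> {a..b}"
proof -
  obtain u v where uv: "k = cbox u v" using division_ofD(4)[OF d(1) k] by blast
  have "k \<noteq> {}" "k \<subseteq> {a..b}"
    using division_ofD(2,3)[OF d(1) k] d(2) by auto
  then have "u \<le> v" "a \<le> u" "v \<le> b" "Inf k = u" "Sup k = v"
    by (auto simp: uv)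
  then show "Inf k \<le> Sup k" "Inf k \<in> {a..b}" "Sup k \<in> {a..b}" by auto
qed

lemma absolutely_continuous_cong:
  assumes "absolutely_continuous_fun_on f {a..b}" "\<And>x. x \<in> {a..b} \<Longrightarrow> g x = f x"
  shows "absolutely_continuous_fun_on g {a..b}"
proof -
  have "(\<Sum>k\<in>d. norm (g (Sup k) - g (Inf k))) = (\<Sum>k\<in>d. norm (f (Sup k) - f (Inf k)))"
    if "d division_of t" "t \<subseteq> {a..b}" for d t
    using division_endpoints[OF that] assms(2) by (intro sum.cong) auto
  then show ?thesis
    using assms(1) unfolding absolutely_continuous_fun_on_def by metis
qed

lemma lipschitz_imp_absolutely_continuous:
  assumes lip: "\<And>x y. x \<in> {a..b} \<Longrightarrow> y \<in> {a..b} \<Longrightarrow> norm (f y - f x) \<le> C * \<bar>y - x\<bar>"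
  shows "absolutely_continuous_fun_on f {a..b}"
  unfolding absolutely_continuous_fun_on_def
proof (intro allI impI)
  fix \<epsilon> :: real assume "\<epsilon> > 0"
  have "(\<Sum>k\<in>d. norm (f (Sup k) - f (Inf k))) < \<epsilon>"
    if d: "d division_of t" "t \<subseteq> {a..b}" "(\<Sum>k\<in>d. Sup k - Inf k) < \<epsilon> / (\<bar>C\<bar> + 1)" for d t
  proof -
    have "(\<Sum>k\<in>d. norm (f (Sup k) - f (Inf k))) \<le> (\<Sum>k\<in>d. (\<bar>C\<bar> + 1) * (Sup k - Inf k))"
    proof (rule sum_mono)
      fix k assume k: "k \<in> d"
      note e = division_endpoints[OF d(1,2) k]
      have "norm (f (Sup k) - f (Inf k)) \<le> C * \<bar>Sup k - Inf k\<bar>" using lip e by blast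
      also have "\<dots> \<le> (\<bar>C\<bar> + 1) * (Sup k - Inf k)"
        using e(1) by (intro mult_mono) auto
      finally show "norm (f (Sup k) - f (Inf k)) \<le> (\<bar>C\<bar> + 1) * (Sup k - Inf k)" .
    qed
    also have "\<dots> = (\<bar>C\<bar> + 1) * (\<Sum>k\<in>d. Sup k - Inf k)"
      by (simp add: sum_distrib_left)
    also have "\<dots> < \<epsilon>"
      using d(3) by (simp add: pos_less_divide_eq mult.commute)
    finally show ?thesis .
  qed
  with \<open>\<epsilon> > 0\<close> show "\<exists>\<delta>>0. \<forall>d t. d division_of t \<and> t \<subseteq> {a..b} \<and> (\<Sum>k\<in>d. Sup k - Inf k) < \<delta> \<longrightarrow>
      (\<Sum>k\<in>d. norm (f (Sup k) - f (Inf k))) < \<epsilon>"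
    by (intro exI[of _ "\<epsilon> / (\<bar>C\<bar> + 1)"]) auto
qed

lemma absolutely_continuous_mult:
  assumes f: "absolutely_continuous_fun_on f {a..b}" and g: "absolutely_continuous_fun_on g {a..b}"
  shows "absolutely_continuous_fun_on (\<lambda>x. f x * g x) {a..b}"
  unfolding absolutely_continuous_fun_on_def
proof (intro allI impI)
  fix \<epsilon> :: real assume \<epsilon>: "\<epsilon> > 0"
  have "bounded (f ` {a..b})" "bounded (g ` {a..b})"
    using f g by (auto intro!: compact_imp_bounded compact_continuous_image
        absolutely_continuous_imp_continuous_on)
  then obtain C D where "C > 0" "D > 0" and C: "\<And>x. x \<in> {a..b} \<Longrightarrow> norm (f x) \<le> C"
    and D: "\<And>x. x \<in> {a..b} \<Longrightarrow> norm (g x) \<le> D"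
    unfolding bounded_pos by auto
  have "\<epsilon> / (2 * D) > 0" "\<epsilon> / (2 * C) > 0" using \<epsilon> \<open>C > 0\<close> \<open>D > 0\<close> by auto
  obtain \<delta>1 where "\<delta>1 > 0"
    and \<delta>1: "\<And>d t. d division_of t \<Longrightarrow> t \<subseteq> {a..b} \<Longrightarrow> (\<Sum>k\<in>d. Sup k - Inf k) < \<delta>1 \<Longrightarrow>
        (\<Sum>k\<in>d. norm (f (Sup k) - f (Inf k))) < \<epsilon> / (2 * D)"
    using absolutely_continuousE[OF f \<open>\<epsilon> / (2 * D) > 0\<close>] by blast
  obtain \<delta>2 where "\<delta>2 > 0"
    and \<delta>2: "\<And>d t. d division_of t \<Longrightarrow> t \<subseteq> {a..b} \<Longrightarrow> (\<Sum>k\<in>d. Sup k - Inf k) < \<delta>2 \<Longrightarrow>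
        (\<Sum>k\<in>d. norm (g (Sup k) - g (Inf k))) < \<epsilon> / (2 * C)"
    using absolutely_continuousE[OF g \<open>\<epsilon> / (2 * C) > 0\<close>] by blast
  have "(\<Sum>k\<in>d. norm (f (Sup k) * g (Sup k) - f (Inf k) * g (Inf k))) < \<epsilon>"
    if d: "d division_of t" "t \<subseteq> {a..b}" "(\<Sum>k\<in>d. Sup k - Inf k) < min \<delta>1 \<delta>2" for d t
  proof -
    have "(\<Sum>k\<in>d. norm (f (Sup k) * g (Sup k) - f (Inf k) * g (Inf k)))
        \<le> (\<Sum>k\<in>d. D * norm (f (Sup k) - f (Inf k)) + C * norm (g (Sup k) - g (Inf k)))"
    proof (rule sum_mono)
      fix k assume k: "k \<in> d"
      note e = division_endpoints[OF d(1,2) k]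
      have "f (Sup k) * g (Sup k) - f (Inf k) * g (Inf k)
          = (f (Sup k) - f (Inf k)) * g (Sup k) + f (Inf k) * (g (Sup k) - g (Inf k))"
        by (simp add: algebra_simps)
      also have "norm \<dots> \<le> norm (f (Sup k) - f (Inf k)) * norm (g (Sup k))
          + norm (f (Inf k)) * norm (g (Sup k) - g (Inf k))"
        by (metis norm_mult norm_triangle_ineq)
      also have "\<dots> \<le> norm (f (Sup k) - f (Inf k)) * D + C * norm (g (Sup k) - g (Inf k))"
        using C D e by (intro add_mono mult_left_mono mult_right_mono) auto
      finally show "norm (f (Sup k) * g (Sup k) - f (Inf k) * g (Inf k))
          \<le> D * norm (f (Sup k) - f (Inf k)) + C * norm (g (Sup k) - g (Inf k))"
        by (simp add: mult.commute)
    qed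
    also have "\<dots> = D * (\<Sum>k\<in>d. norm (f (Sup k) - f (Inf k)))
        + C * (\<Sum>k\<in>d. norm (g (Sup k) - g (Inf k)))"
      by (simp add: sum.distrib sum_distrib_left)
    also have "\<dots> < D * (\<epsilon> / (2 * D)) + C * (\<epsilon> / (2 * C))"
      using \<delta>1[OF d(1,2)] \<delta>2[OF d(1,2)] d(3) \<open>C > 0\<close> \<open>D > 0\<close>
      by (intro add_strict_mono mult_strict_left_mono) auto
    also have "\<dots> = \<epsilon>" using \<open>C > 0\<close> \<open>D > 0\<close> by simp
    finally show ?thesis .
  qed
  with \<open>\<delta>1 > 0\<close> \<open>\<delta>2 > 0\<close> show "\<exists>\<delta>>0. \<forall>d t. d division_of t \<and> t \<subseteq> {a..b} \<and>
      (\<Sum>k\<in>d. Sup k - Inf k) < \<delta> \<longrightarrow>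
      (\<Sum>k\<in>d. norm (f (Sup k) * g (Sup k) - f (Inf k) * g (Inf k))) < \<epsilon>"
    by (intro exI[of _ "min \<delta>1 \<delta>2"]) auto
qed

lemma absolutely_continuous_exp:
  "absolutely_continuous_fun_on (\<lambda>x. exp (c * complex_of_real x)) {a..b}"
proof (rule lipschitz_imp_absolutely_continuous)
  define C where "C = norm c * exp (norm c * (\<bar>a\<bar> + \<bar>b\<bar>))"
  fix x y assume x: "x \<in> {a..b}" and y: "y \<in> {a..b}"
  have "norm (exp (c * of_real y) - exp (c * of_real x)) \<le> C * norm (y - x)"
  proof (rule differentiable_bound[OF convex_real_interval(5) _ _ y x])
    fix u assume u: "u \<in> {a..b}"
    have "((\<lambda>z. exp (c * z)) has_field_derivative c * exp (c * of_real u)) (at (of_real u))"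
      by (auto intro!: derivative_eq_intros)
    then have "((\<lambda>x. exp (c * of_real x)) has_vector_derivative c * exp (c * of_real u)) (at u within {a..b})"
      by (rule has_vector_derivative_real_field)
    then show "((\<lambda>x. exp (c * of_real x)) has_derivative (\<lambda>h. h *\<^sub>R (c * exp (c * of_real u))))
        (at u within {a..b})"
      by (simp add: has_vector_derivative_def)
    have "norm (exp (c * of_real u)) \<le> exp (norm c * (\<bar>a\<bar> + \<bar>b\<bar>))"
    proof -
      have "norm (exp (c * of_real u)) \<le> exp (norm (c * of_real u))"
        by (rule norm_exp)
      also have "\<dots> \<le> exp (norm c * (\<bar>a\<bar> + \<bar>b\<bar>))"
        using u by (auto simp: norm_mult intro!: mult_left_mono)
      finally show ?thesis .
    qed
    then show "onorm (\<lambda>h. h *\<^sub>R (c * exp (c * of_real u))) \<le> C"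
      by (intro onorm_le) (auto simp: C_def norm_mult mult.commute intro!: mult_left_mono)
  qed
  then show "norm (exp (c * of_real y) - exp (c * of_real x)) \<le> C * \<bar>y - x\<bar>" by simp
qed

lemma absolutely_continuous_subset:
  assumes "absolutely_continuous_fun_on f I" "J \<subseteq> I"
  shows "absolutely_continuous_fun_on f J"
  unfolding absolutely_continuous_fun_on_def
proof (intro allI impI)
  fix \<epsilon> :: real assume "\<epsilon> > 0"
  then obtain \<delta> where "\<delta> > 0" and \<delta>: "\<And>d t. d division_of t \<Longrightarrow> t \<subseteq> I \<Longrightarrow>
      (\<Sum>k\<in>d. Sup k - Inf k) < \<delta> \<Longrightarrow> (\<Sum>k\<in>d. norm (f (Sup k) - f (Inf k))) < \<epsilon>"
    using absolutely_continuousE[OF assms(1)] by blast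
  then show "\<exists>\<delta>>0. \<forall>d t. d division_of t \<and> t \<subseteq> J \<and> (\<Sum>k\<in>d. Sup k - Inf k) < \<delta> \<longrightarrow>
      (\<Sum>k\<in>d. norm (f (Sup k) - f (Inf k))) < \<epsilon>"
    using assms(2) by (intro exI[of _ \<delta>]) (auto intro!: \<delta>)
qed

section \<open>The fundamental theorem of calculus for absolutely continuous functions\<close>

lemma sum_length_division_le_measure:
  fixes d :: "real set set"
  assumes d: "d division_of t" and T: "t \<subseteq> T" "T \<in> lmeasurable"
  shows "(\<Sum>k\<in>d. Sup k - Inf k) \<le> measure lebesgue T"
proof -
  have "((\<lambda>x. 1::real) has_integral (Sup k - Inf k)) k" if k: "k \<in> d" for k
  proof -
    obtain u v where uv: "k = cbox u v" using division_ofD(4)[OF d k] by blast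
    moreover have "k \<noteq> {}" using division_ofD(3)[OF d k] .
    ultimately show ?thesis
      using has_integral_const_real[of "1::real" u v] by (simp add: box_real)
  qed
  then have "((\<lambda>x. 1::real) has_integral (\<Sum>k\<in>d. Sup k - Inf k)) t"
    by (intro has_integral_combine_division[OF d])
  moreover have "((\<lambda>x. 1::real) has_integral measure lebesgue T) T"
    using lmeasure_integral[OF T(2)] integrable_on_const[OF T(2), of "1::real"]
    by (simp add: has_integral_iff)
  ultimately show ?thesis
    by (rule has_integral_subset_le[OF T(1)]) simp
qed

text \<open>The gauge integral makes this direct. At points where \<open>f\<close> is differentiable a fine gauge makes
  the Riemann sum follow the increments of \<open>f\<close>. For tags in the exceptional null set \<open>N\<close> the gauge is
  an open set around \<open>N\<close> of measure less than \<open>\<delta>\<close>; the intervals with such tags have total length less than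
  \<open>\<delta>\<close>, so by absolute continuity the increments of \<open>f\<close> over them are small.\<close>
lemma has_integral_derivative_of_absolutely_continuous:
  fixes f f' :: "real \<Rightarrow> complex"
  assumes ac: "absolutely_continuous_fun_on f {a..b}" and "a \<le> b" and N: "negligible N"
    and deriv: "\<And>x. x \<in> {a..b} - N \<Longrightarrow> (f has_vector_derivative f' x) (at x within {a..b})"
  shows "(f' has_integral (f b - f a)) {a..b}"
proof (cases "a = b")
  case True then show ?thesis using has_integral_refl(2)[of f' a] by (simp add: box_real)
next
  case False
  with \<open>a \<le> b\<close> have "a < b" by simp
  define g where "g x = (if x \<in> N then 0 else f' x)" for x
  have "(g has_integral (f b - f a)) {a..b}"
    unfolding has_integral_factor_content_real
  proof (intro allI impI)
    fix e :: real assume "e > 0"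
    have "\<forall>x. \<exists>r>0. x \<in> {a..b} - N \<longrightarrow> (\<forall>y\<in>{a..b}. norm (y - x) < r \<longrightarrow>
        norm (f y - f x - (y - x) *\<^sub>R f' x) \<le> e / 2 * norm (y - x))"
      using deriv \<open>e > 0\<close> unfolding has_vector_derivative_def has_derivative_within_alt
      by (metis half_gt_zero zero_less_one)
    then obtain r where r: "\<And>x. 0 < r x" and straddle:
      "\<And>x y. x \<in> {a..b} - N \<Longrightarrow> y \<in> {a..b} \<Longrightarrow> norm (y - x) < r x \<Longrightarrow>
        norm (f y - f x - (y - x) *\<^sub>R f' x) \<le> e / 2 * norm (y - x)"
      by metis
    have "e / 2 * (b - a) > 0" using \<open>a < b\<close> \<open>e > 0\<close> by simp
    then obtain \<delta> where "\<delta> > 0" and \<delta>: "\<And>d t. d division_of t \<Longrightarrow> t \<subseteq> {a..b} \<Longrightarrow>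
        (\<Sum>k\<in>d. Sup k - Inf k) < \<delta> \<Longrightarrow>
        (\<Sum>k\<in>d. norm (f (Sup k) - f (Inf k))) < e / 2 * (b - a)"
      using absolutely_continuousE[OF ac \<open>e / 2 * (b - a) > 0\<close>] by blast
    have Nn: "N \<in> null_sets lebesgue" using N negligible_iff_null_sets by blast
    obtain T where T: "open T" "N \<subseteq> T" "T - N \<in> lmeasurable"
      "emeasure lebesgue (T - N) < ennreal \<delta>"
      using sets_lebesgue_outer_open[OF _ \<open>\<delta> > 0\<close>, of N] Nn by blast
    have "T = (T - N) \<union> N" using T(2) by blast
    with T(3,4) Nn have Tm: "T \<in> lmeasurable" "measure lebesgue T < \<delta>"
    proof -
      show "T \<in> lmeasurable"
        using T(3) N \<open>T = _\<close> by (metis fmeasurable.Un negligible_imp_measurable)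
      have "measure lebesgue T = measure lebesgue (T - N)"
        using Nn T(3) by (metis \<open>T = _\<close> fmeasurableD measure_Un_null_set)
      also have "\<dots> < \<delta>"
        using T(3,4) \<open>\<delta> > 0\<close> by (simp add: emeasure_eq_measure2 ennreal_less_iff)
      finally show "measure lebesgue T < \<delta>" .
    qed
    \<comment> \<open>tags in \<open>N\<close> are confined to a small neighbourhood of \<open>N\<close>\<close>
    define \<gamma> where "\<gamma> x = (if x \<in> N then T else ball x (r x))" for x
    have gauge: "gauge \<gamma>"
      unfolding gauge_def \<gamma>_def using T(1,2) r by auto
    have fine: "norm ((\<Sum>(x, k)\<in>p. measure lborel k *\<^sub>R g x) - (f b - f a)) \<le> e * measure lborel {a..b}"
      if p: "p tagged_division_of {a..b}" "\<gamma> fine p" for p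
    proof -
      define q where "q = {z \<in> p. fst z \<in> N}"
      have fin: "finite p" using p(1) by blast
      have qp: "q \<subseteq> p" by (auto simp: q_def)
      have K: "\<exists>u v. k = {u..v} \<and> u \<le> v \<and> a \<le> u \<and> v \<le> b \<and> u \<le> x \<and> x \<le> v \<and> k \<subseteq> \<gamma> x"
        if xk: "(x, k) \<in> p" for x k
      proof -
        obtain u v where uv: "k = cbox u v" using tagged_division_ofD(4)[OF p(1) xk] by blast
        have "x \<in> k" "k \<subseteq> {a..b}" using tagged_division_ofD(2,3)[OF p(1) xk] by auto
        moreover have "k \<subseteq> \<gamma> x" using p(2) xk by (auto simp: fine_def)
        ultimately show ?thesis using uv by (intro exI[of _ u] exI[of _ v]) auto
      qed
      have qd: "q tagged_division_of \<Union>(snd ` q)"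
        by (rule tagged_partial_division_of_Union_self[OF tagged_partial_division_subset[OF _ qp]])
          (rule p(1)[unfolded tagged_division_of_def, THEN conjunct1])
      then have qdiv: "snd ` q division_of \<Union>(snd ` q)"
        by (rule division_of_tagged_division)
      have "\<Union>(snd ` q) \<subseteq> T"
        using K by (force simp: q_def \<gamma>_def)
      then have "(\<Sum>k\<in>snd ` q. Sup k - Inf k) < \<delta>"
        using sum_length_division_le_measure[OF qdiv _ Tm(1)] Tm(2) by fastforce
      moreover have "\<Union>(snd ` q) \<subseteq> {a..b}"
        using tagged_division_ofD(3)[OF p(1)] qp by fastforce
      ultimately have "(\<Sum>k\<in>snd ` q. norm (f (Sup k) - f (Inf k))) < e / 2 * (b - a)"
        using \<delta>[OF qdiv] by blast
      moreover have "(\<Sum>(x, k)\<in>q. norm (f (Sup k) - f (Inf k)))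
          = (\<Sum>k\<in>snd ` q. norm (f (Sup k) - f (Inf k)))"
      proof -
        \<comment> \<open>\<open>Inf\<close> and \<open>Sup\<close> of the empty set are unspecified, so it needs a value of its own\<close>
        define h where "h k = (if k = {} then 0 else norm (f (Sup k) - f (Inf k)))" for k
        have "(\<Sum>(x, k)\<in>q. h k) = sum h (snd ` q)"
        proof (rule sum.over_tagged_division_lemma[OF qd])
          fix u v :: real assume "box u v = {}"
          then show "h (cbox u v) = 0"
            by (cases "u = v") (auto simp: h_def)
        qed
        moreover have "(\<Sum>(x, k)\<in>q. h k) = (\<Sum>(x, k)\<in>q. norm (f (Sup k) - f (Inf k)))"
          using K qp by (intro sum.cong) (force simp: h_def)+
        moreover have "sum h (snd ` q) = (\<Sum>k\<in>snd ` q. norm (f (Sup k) - f (Inf k)))"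
          using K qp by (intro sum.cong) (force simp: h_def)+
        ultimately show ?thesis by simp
      qed
      ultimately have sumq: "(\<Sum>(x, k)\<in>q. norm (f (Sup k) - f (Inf k))) \<le> e / 2 * (b - a)"
        by simp
      have ba: "b - a = (\<Sum>(x, k)\<in>p. Sup k - Inf k)" "f b - f a = (\<Sum>(x, k)\<in>p. f (Sup k) - f (Inf k))"
        using additive_tagged_division_1[OF \<open>a \<le> b\<close> p(1), of "\<lambda>x. x"]
          additive_tagged_division_1[OF \<open>a \<le> b\<close> p(1), of f] by auto
      have "(\<Sum>(x, k)\<in>p. measure lborel k *\<^sub>R g x) - (f b - f a)
          = (\<Sum>(x, k)\<in>p. measure lborel k *\<^sub>R g x - (f (Sup k) - f (Inf k)))"
        by (simp add: ba(2) sum_subtractf split_def)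
      also have "norm \<dots> \<le> (\<Sum>(x, k)\<in>p. e / 2 * (Sup k - Inf k)
          + (if x \<in> N then norm (f (Sup k) - f (Inf k)) else 0))"
      proof (rule sum_norm_le, clarify)
        fix x k assume "(x, k) \<in> p"
        from K[OF this] obtain u v where uv: "k = {u..v}" "u \<le> v" "a \<le> u" "v \<le> b" "u \<le> x" "x \<le> v"
          "k \<subseteq> \<gamma> x" by blast
        show "norm (measure lborel k *\<^sub>R g x - (f (Sup k) - f (Inf k))) \<le> e / 2 * (Sup k - Inf k)
          + (if x \<in> N then norm (f (Sup k) - f (Inf k)) else 0)"
        proof (cases "x \<in> N")
          case True
          then show ?thesis using uv \<open>e > 0\<close> by (auto simp: g_def norm_minus_commute)
        next
          case False
          have "u \<in> ball x (r x)" "v \<in> ball x (r x)"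
            using uv False subsetD[of "{u..v}" "ball x (r x)"] by (simp_all add: \<gamma>_def)
          then have near: "norm (u - x) < r x" "norm (v - x) < r x"
            by (auto simp: dist_norm norm_minus_commute)
          have "norm (f u - f x - (u - x) *\<^sub>R f' x) \<le> e / 2 * norm (u - x)"
            "norm (f v - f x - (v - x) *\<^sub>R f' x) \<le> e / 2 * norm (v - x)"
            using near uv False by (intro straddle; auto)+
          moreover have "measure lborel k *\<^sub>R g x - (f (Sup k) - f (Inf k))
              = (f u - f x - (u - x) *\<^sub>R f' x) - (f v - f x - (v - x) *\<^sub>R f' x)"
            using uv False by (simp add: g_def algebra_simps)
          ultimately have "norm (measure lborel k *\<^sub>R g x - (f (Sup k) - f (Inf k)))
              \<le> e / 2 * norm (u - x) + e / 2 * norm (v - x)"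
            by (smt (verit) norm_triangle_ineq4)
          also have "\<dots> = e / 2 * (Sup k - Inf k)"
            using uv by (simp add: field_simps)
          finally show ?thesis using False by simp
        qed
      qed
      also have "\<dots> = e / 2 * (\<Sum>(x, k)\<in>p. Sup k - Inf k)
          + (\<Sum>(x, k)\<in>p. if x \<in> N then norm (f (Sup k) - f (Inf k)) else 0)"
        by (simp add: split_def sum.distrib sum_distrib_left)
      also have "(\<Sum>(x, k)\<in>p. if x \<in> N then norm (f (Sup k) - f (Inf k)) else 0)
          = (\<Sum>(x, k)\<in>q. norm (f (Sup k) - f (Inf k)))"
        unfolding q_def using fin by (simp add: split_def sum.inter_filter)
      also have "e / 2 * (\<Sum>(x, k)\<in>p. Sup k - Inf k) + \<dots> \<le> e * measure lborel {a..b}"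
        using sumq \<open>a < b\<close> by (simp add: ba(1)[symmetric] field_simps)
      finally show ?thesis .
    qed
    show "\<exists>\<gamma>. gauge \<gamma> \<and> (\<forall>p. p tagged_division_of {a..b} \<and> \<gamma> fine p \<longrightarrow>
        norm ((\<Sum>(x, k)\<in>p. measure lborel k *\<^sub>R g x) - (f b - f a)) \<le> e * measure lborel {a..b})"
      using gauge fine by (intro exI[of _ \<gamma>] conjI allI impI) simp_all
  qed
  then show ?thesis
    by (rule has_integral_spike[OF N, rotated]) (simp add: g_def)
qed

text \<open>Cut the integrand at height \<open>n\<close>. The part above the cut has an integral that tends to zero by
  dominated convergence, and the part below contributes at most \<open>n\<close> times the total length of the division.\<close>
lemma absolutely_continuous_indefinite_integral:
  fixes g :: "real \<Rightarrow> complex"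
  assumes g: "g absolutely_integrable_on {a..b}"
  shows "absolutely_continuous_fun_on (\<lambda>x. c + integral {a..x} g) {a..b}"
  unfolding absolutely_continuous_fun_on_def
proof (intro allI impI)
  fix \<epsilon> :: real assume "\<epsilon> > 0"
  have gi: "g integrable_on {a..b}" "(\<lambda>x. norm (g x)) integrable_on {a..b}"
    using g by (auto simp: absolutely_integrable_on_def)
  define h where "h n x = norm (g x) - min (norm (g x)) (real n)" for n x
  have hi: "h n integrable_on {a..b}" for n
  proof -
    have "(\<lambda>x. norm (g x)) absolutely_integrable_on {a..b}"
      using g by (rule absolutely_integrable_norm[unfolded o_def])
    then have "(\<lambda>x. min (norm (g x)) (real n)) absolutely_integrable_on {a..b}"
      by (intro absolutely_integrable_min_1) auto
    then show ?thesis
      unfolding h_def using gi(2) by (intro integrable_diff) (auto simp: absolutely_integrable_on_def)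
  qed
  have bound: "norm (g x) \<le> real n + h n x" for n x
    by (simp add: h_def)
  have "(\<lambda>n. integral {a..b} (h n)) \<longlonglongrightarrow> integral {a..b} (\<lambda>x. 0)"
  proof (rule dominated_convergence(2)[OF hi gi(2)])
    show "norm (h n x) \<le> norm (g x)" for n x
      by (auto simp: h_def min_def)
    show "(\<lambda>n. h n x) \<longlonglongrightarrow> 0" for x
    proof (rule tendsto_eventually)
      show "\<forall>\<^sub>F n in sequentially. h n x = 0"
        using eventually_ge_at_top[of "nat \<lceil>norm (g x)\<rceil>"]
        by eventually_elim (auto simp: h_def min_def nat_le_iff ceiling_le_iff)
    qed
  qed
  then have "\<forall>\<^sub>F n in sequentially. integral {a..b} (h n) < \<epsilon> / 2"
    using \<open>\<epsilon> > 0\<close> by (intro order_tendstoD) auto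
  then obtain n where n: "integral {a..b} (h n) < \<epsilon> / 2"
    by (auto simp: eventually_sequentially)
  have "(\<Sum>k\<in>d. norm ((c + integral {a..Sup k} g) - (c + integral {a..Inf k} g))) < \<epsilon>"
    if d: "d division_of t" "t \<subseteq> {a..b}" "(\<Sum>k\<in>d. Sup k - Inf k) < \<epsilon> / (2 * (real n + 1))" for d t
  proof -
    have "(\<Sum>k\<in>d. norm ((c + integral {a..Sup k} g) - (c + integral {a..Inf k} g)))
        \<le> (\<Sum>k\<in>d. real n * (Sup k - Inf k) + integral k (h n))"
    proof (rule sum_mono)
      fix k assume k: "k \<in> d"
      obtain u v where uv: "k = cbox u v" using division_ofD(4)[OF d(1) k] by blast
      have "k \<noteq> {}" "k \<subseteq> {a..b}" using division_ofD(2,3)[OF d(1) k] d(2) by auto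
      then have uv': "u \<le> v" "a \<le> u" "v \<le> b" "Inf k = u" "Sup k = v" by (auto simp: uv)
      have sub: "f integrable_on {u..v}" if "f integrable_on {a..b}" for f :: "real \<Rightarrow> 'x::banach"
        by (rule integrable_on_subinterval[OF that]) (use uv' in auto)
      have "integral {a..u} g + integral {u..v} g = integral {a..v} g"
        using uv' by (intro Henstock_Kurzweil_Integration.integral_combine)
          (auto intro: integrable_on_subinterval[OF gi(1)])
      then have "(c + integral {a..Sup k} g) - (c + integral {a..Inf k} g) = integral {u..v} g"
        using uv' by (simp add: algebra_simps)
      also have "norm \<dots> \<le> integral {u..v} (\<lambda>x. real n + h n x)"
        by (rule Henstock_Kurzweil_Integration.integral_norm_bound_integral)
          (auto intro!: sub gi(1) integrable_add hi bound)
      also have "\<dots> = real n * (v - u) + integral {u..v} (h n)"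
        using uv'(1) by (subst Henstock_Kurzweil_Integration.integral_add) (auto intro!: sub hi)
      finally show "norm ((c + integral {a..Sup k} g) - (c + integral {a..Inf k} g))
          \<le> real n * (Sup k - Inf k) + integral k (h n)"
        using uv' by (simp add: uv)
    qed
    also have "\<dots> = real n * (\<Sum>k\<in>d. Sup k - Inf k) + (\<Sum>k\<in>d. integral k (h n))"
      by (simp add: sum.distrib sum_distrib_left)
    also have "(\<Sum>k\<in>d. integral k (h n)) = integral t (h n)"
      using integral_unique[OF has_integral_combine_division_topdown[OF hi d(1,2)]] by simp
    also have "integral t (h n) \<le> integral {a..b} (h n)"
      using integrable_on_def has_integral_combine_division_topdown[OF hi d(1,2)]
      by (intro integral_subset_le d(2) hi) (auto simp: h_def)
    also have "real n * (\<Sum>k\<in>d. Sup k - Inf k) + integral {a..b} (h n) < \<epsilon>"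
    proof -
      have "real n * (\<Sum>k\<in>d. Sup k - Inf k) \<le> real n * (\<epsilon> / (2 * (real n + 1)))"
        using d(3) by (intro mult_left_mono) auto
      also have "\<dots> \<le> \<epsilon> / 2"
        using \<open>\<epsilon> > 0\<close> by (simp add: field_simps)
      finally show ?thesis using n by simp
    qed
    finally show ?thesis by simp
  qed
  with \<open>\<epsilon> > 0\<close> show "\<exists>\<delta>>0. \<forall>d t. d division_of t \<and> t \<subseteq> {a..b} \<and> (\<Sum>k\<in>d. Sup k - Inf k) < \<delta> \<longrightarrow>
      (\<Sum>k\<in>d. norm ((c + integral {a..Sup k} g) - (c + integral {a..Inf k} g))) < \<epsilon>"
    by (intro exI[of _ "\<epsilon> / (2 * (real n + 1))"]) auto
qed

text \<open>Lebesgue's differentiation theorem. The library theorem \<open>integrable_ccontinuous_explicit\<close> averages over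
  intervals to the right of a point; applied to the reflected function it gives the averages to
  the left, and both together give the derivative.\<close>
lemma has_vector_derivative_indefinite_integral_ae:
  fixes g :: "real \<Rightarrow> complex"
  assumes g: "g integrable_on {a..b}"
  obtains N where "negligible N"
    "\<And>x. x \<in> {a<..<b} - N \<Longrightarrow> ((\<lambda>x. integral {a..x} g) has_vector_derivative g x) (at x)"
proof -
  define g0 where "g0 x = (if x \<in> {a..b} then g x else 0)" for x
  have "g0 integrable_on UNIV"
    unfolding g0_def using g integrable_restrict_UNIV by blast
  then have g0: "g0 integrable_on cbox u v" for u v
    using integrable_on_subcbox by blast
  have g0m: "(\<lambda>x. g0 (- x)) integrable_on cbox u v" for u v
    using g0[of "-v" "-u"] Henstock_Kurzweil_Integration.integrable_reflect_real[of g0 "-u" "-v"] by simp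
  have right: "\<exists>N. negligible N \<and> (\<forall>x e. x \<notin> N \<longrightarrow> 0 < e \<longrightarrow> (\<exists>d>0. \<forall>h. 0 < h \<and> h < d \<longrightarrow>
        norm (integral {x..x + h} k /\<^sub>R h - k x) < e))"
    if "\<And>u v. k integrable_on cbox u v" for k :: "real \<Rightarrow> complex"
    by (rule integrable_ccontinuous_explicit[OF that]) (auto simp: Basis_real_def)
  obtain N1 where N1: "negligible N1" "\<forall>x e. x \<notin> N1 \<longrightarrow> 0 < e \<longrightarrow> (\<exists>d>0. \<forall>h. 0 < h \<and> h < d \<longrightarrow>
        norm (integral {x..x + h} g0 /\<^sub>R h - g0 x) < e)"
    using right[OF g0] by (elim exE conjE)
  obtain N2 where N2: "negligible N2" "\<forall>x e. x \<notin> N2 \<longrightarrow> 0 < e \<longrightarrow> (\<exists>d>0. \<forall>h. 0 < h \<and> h < d \<longrightarrow>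
        norm (integral {x..x + h} (\<lambda>x. g0 (- x)) /\<^sub>R h - g0 (- x)) < e)"
    using right[OF g0m] by (elim exE conjE)
  show thesis
  proof
    show "negligible (N1 \<union> uminus ` N2)"
      using N1(1) N2(1) by (intro negligible_Un negligible_differentiable_image_negligible) 
        (auto intro!: derivative_intros simp: differentiable_on_def)
    fix x assume x: "x \<in> {a<..<b} - (N1 \<union> uminus ` N2)"
    then have xN: "x \<notin> N1" "-x \<notin> N2" by force+
    have g0x: "g0 x = g x" using x by (simp add: g0_def)
    show "((\<lambda>x. integral {a..x} g) has_vector_derivative g x) (at x)"
      unfolding has_vector_derivative_def has_derivative_at_alt
    proof (intro conjI allI impI)
      fix e :: real assume "e > 0"
      obtain d1 where "d1 > 0" and d1: "\<And>h. 0 < h \<Longrightarrow> h < d1 \<Longrightarrow>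
          norm (integral {x..x + h} g0 /\<^sub>R h - g0 x) < e"
        using N1(2)[rule_format, OF xN(1) \<open>e > 0\<close>] by blast
      obtain d2 where "d2 > 0" and d2: "\<And>h. 0 < h \<Longrightarrow> h < d2 \<Longrightarrow>
          norm (integral {-x..-x + h} (\<lambda>x. g0 (- x)) /\<^sub>R h - g0 x) < e"
        using N2(2)[rule_format, OF xN(2) \<open>e > 0\<close>] by auto
      define d where "d = Min {d1, d2, x - a, b - x}"
      have d: "d \<le> d1" "d \<le> d2" "d \<le> x - a" "d \<le> b - x" by (simp_all add: d_def)
      have "d > 0" using x \<open>d1 > 0\<close> \<open>d2 > 0\<close> by (simp add: d_def)
      have incr: "integral {a..v} g - integral {a..u} g = integral {u..v} g0"
        if "a \<le> u" "u \<le> v" "v \<le> b" for u v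
      proof -
        have "integral {a..u} g + integral {u..v} g = integral {a..v} g"
          using that by (intro Henstock_Kurzweil_Integration.integral_combine)
            (auto intro: integrable_on_subinterval[OF g])
        moreover have "integral {u..v} g = integral {u..v} g0"
          using that by (intro Henstock_Kurzweil_Integration.integral_cong) (auto simp: g0_def)
        ultimately show ?thesis by (simp add: algebra_simps)
      qed
      have scale: "norm (I - h *\<^sub>R w) \<le> e * h" if "norm (I /\<^sub>R h - w) < e" "h > 0" for I w :: complex and h
      proof -
        have "I - h *\<^sub>R w = h *\<^sub>R (I /\<^sub>R h - w)" using \<open>h > 0\<close> by (simp add: algebra_simps)
        then have "norm (I - h *\<^sub>R w) = h * norm (I /\<^sub>R h - w)" using \<open>h > 0\<close> by simp
        then show ?thesis using that by (simp add: mult.commute)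
      qed
      have "norm (integral {a..y} g - integral {a..x} g - (y - x) *\<^sub>R g x) \<le> e * norm (y - x)"
        if y: "norm (y - x) < d" for y
      proof (cases x y rule: linorder_cases)
        case less
        have "norm (integral {x..x + (y - x)} g0 - (y - x) *\<^sub>R g0 x) \<le> e * (y - x)"
          using y d less by (intro scale d1) auto
        then show ?thesis
          using incr[of x y] x y d less by (simp add: g0x)
      next
        case greater
        have "norm (integral {-x..-x + (x - y)} (\<lambda>x. g0 (- x)) - (x - y) *\<^sub>R g0 x) \<le> e * (x - y)"
          using y d greater by (intro scale d2) auto
        moreover have "integral {-x..-x + (x - y)} (\<lambda>x. g0 (- x)) = integral {y..x} g0"
          using Henstock_Kurzweil_Integration.integral_reflect_real[of x y g0] by simp
        moreover have "integral {a..y} g - integral {a..x} g - (y - x) *\<^sub>R g x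
            = - (integral {y..x} g0 - (x - y) *\<^sub>R g0 x)"
          using incr[of y x] x y d greater by (simp add: g0x algebra_simps)
        ultimately show ?thesis
          using greater by (simp only: norm_minus_cancel) simp
      qed simp
      with \<open>d > 0\<close> show "\<exists>d>0. \<forall>y. norm (y - x) < d \<longrightarrow>
          norm (integral {a..y} g - integral {a..x} g - (y - x) *\<^sub>R g x) \<le> e * norm (y - x)"
        by blast
    qed (rule bounded_linear_scaleR_left)
  qed
qed

section \<open>Inhomogeneous first-order linear equations\<close>

lemma absolutely_integrable_exp_mult:
  fixes r :: "real \<Rightarrow> complex"
  assumes r: "r absolutely_integrable_on {a..b}"
  shows "(\<lambda>t. exp (c * complex_of_real t) * r t) absolutely_integrable_on {a..b}"
proof (rule absolutely_integrable_bounded_measurable_product[where h="(*)", OF _ _ _ _ r])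
  have cont: "continuous_on {a..b} (\<lambda>t. exp (c * complex_of_real t))"
    by (intro continuous_intros)
  then show "(\<lambda>t. exp (c * complex_of_real t)) \<in> borel_measurable (lebesgue_on {a..b})"
    by (rule continuous_imp_measurable_on_sets_lebesgue) auto
  show "bilinear ((*) :: complex \<Rightarrow> complex \<Rightarrow> complex)"
    by (simp add: bilinear_conv_bounded_bilinear bounded_bilinear_mult)
  show "bounded ((\<lambda>t. exp (c * complex_of_real t)) ` {a..b})"
    using cont by (intro compact_imp_bounded compact_continuous_image) auto
qed auto

text \<open>The integrating factor \<open>exp (- \<kappa> t)\<close> turns the equation into \<open>(exp (- \<kappa> t) f)' = exp (- \<kappa> t) r\<close>,
  and the product is again absolutely continuous.\<close>
lemma variation_of_constants:
  fixes f r :: "real \<Rightarrow> complex"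
  assumes ac: "absolutely_continuous_fun_on f {a..b}" and N: "negligible N"
    and deriv: "\<And>x. x \<in> {a..b} - N \<Longrightarrow> (f has_vector_derivative \<kappa> * f x + r x) (at x within {a..b})"
    and x: "x \<in> {a..b}"
  shows "((\<lambda>t. exp (- \<kappa> * of_real t) * r t) has_integral
    exp (- \<kappa> * of_real x) * f x - exp (- \<kappa> * of_real a) * f a) {a..x}"
proof (rule has_integral_derivative_of_absolutely_continuous[OF _ _ N])
  show "a \<le> x" using x by simp
  show "absolutely_continuous_fun_on (\<lambda>t. exp (- \<kappa> * of_real t) * f t) {a..x}"
    using x by (intro absolutely_continuous_subset[OF absolutely_continuous_mult[OF absolutely_continuous_exp ac]])
      auto
  fix t assume t: "t \<in> {a..x} - N"
  have "((\<lambda>z. exp (- \<kappa> * z)) has_field_derivative - \<kappa> * exp (- \<kappa> * of_real t)) (at (of_real t))"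
    by (auto intro!: derivative_eq_intros)
  then have "((\<lambda>t. exp (- \<kappa> * of_real t)) has_vector_derivative - \<kappa> * exp (- \<kappa> * of_real t))
      (at t within {a..x})"
    by (rule has_vector_derivative_real_field)
  moreover have "(f has_vector_derivative \<kappa> * f t + r t) (at t within {a..x})"
    using deriv[of t] t x by (auto intro: has_vector_derivative_within_subset)
  ultimately have "((\<lambda>t. exp (- \<kappa> * of_real t) * f t) has_vector_derivative
      exp (- \<kappa> * of_real t) * (\<kappa> * f t + r t) + - \<kappa> * exp (- \<kappa> * of_real t) * f t) (at t within {a..x})"
    by (rule has_vector_derivative_mult)
  then show "((\<lambda>t. exp (- \<kappa> * of_real t) * f t) has_vector_derivative
      exp (- \<kappa> * of_real t) * r t) (at t within {a..x})"
    by (simp add: algebra_simps)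
qed

lemma variation_of_constants_solution:
  fixes r :: "real \<Rightarrow> complex" and \<kappa> c :: complex
  assumes r: "r absolutely_integrable_on {a..b}"
  defines "f \<equiv> \<lambda>x. exp (\<kappa> * of_real x) * (c + integral {a..x} (\<lambda>t. exp (- \<kappa> * of_real t) * r t))"
  shows "absolutely_continuous_fun_on f {a..b}"
    and "\<exists>N. negligible N \<and> (\<forall>x\<in>{a<..<b} - N. (f has_vector_derivative \<kappa> * f x + r x) (at x))"
proof -
  define s where "s t = exp (- \<kappa> * of_real t) * r t" for t
  have s: "s absolutely_integrable_on {a..b}"
    unfolding s_def by (rule absolutely_integrable_exp_mult[OF r])
  have f: "f = (\<lambda>x. exp (\<kappa> * of_real x) * (c + integral {a..x} s))"
    unfolding f_def s_def by (rule refl)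
  show "absolutely_continuous_fun_on f {a..b}"
    unfolding f
    by (intro absolutely_continuous_mult absolutely_continuous_exp absolutely_continuous_indefinite_integral s)
  obtain N where N: "negligible N"
    "\<And>x. x \<in> {a<..<b} - N \<Longrightarrow> ((\<lambda>x. integral {a..x} s) has_vector_derivative s x) (at x)"
    using has_vector_derivative_indefinite_integral_ae s unfolding absolutely_integrable_on_def by blast
  have "(f has_vector_derivative \<kappa> * f x + r x) (at x)" if x: "x \<in> {a<..<b} - N" for x
  proof -
    have "((\<lambda>z. exp (\<kappa> * z)) has_field_derivative \<kappa> * exp (\<kappa> * of_real x)) (at (of_real x))"
      by (auto intro!: derivative_eq_intros)
    then have "((\<lambda>t. exp (\<kappa> * of_real t)) has_vector_derivative \<kappa> * exp (\<kappa> * of_real x)) (at x)"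
      by (rule has_vector_derivative_real_field)
    moreover have "((\<lambda>x. c + integral {a..x} s) has_vector_derivative s x) (at x)"
      using has_vector_derivative_add[OF has_vector_derivative_const N(2)[OF x]] by simp
    ultimately have "(f has_vector_derivative exp (\<kappa> * of_real x) * s x
        + \<kappa> * exp (\<kappa> * of_real x) * (c + integral {a..x} s)) (at x)"
      unfolding f by (rule has_vector_derivative_mult)
    moreover have "exp (\<kappa> * of_real x) * s x = r x"
      by (simp add: s_def exp_minus)
    ultimately show ?thesis by (simp add: f algebra_simps)
  qed
  with N(1) show "\<exists>N. negligible N \<and> (\<forall>x\<in>{a<..<b} - N. (f has_vector_derivative \<kappa> * f x + r x) (at x))"
    by blast
qed

section \<open>Square-integrable functions on a finite measure space\<close>

lemma norm_add_power2_le: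
  fixes a b :: complex
  shows "(norm (a + b))\<^sup>2 \<le> 2 * (norm a)\<^sup>2 + 2 * (norm b)\<^sup>2"
proof -
  have "(norm (a + b))\<^sup>2 \<le> (norm a + norm b)\<^sup>2"
    by (intro power_mono norm_triangle_ineq norm_ge_zero)
  also have "\<dots> \<le> 2 * (norm a)\<^sup>2 + 2 * (norm b)\<^sup>2"
    using zero_le_power2[of "norm a - norm b"] by (simp add: power2_sum power2_diff)
  finally show ?thesis .
qed

lemma L2_space_add:
  assumes "f \<in> L2_space M" "g \<in> L2_space M"
  shows "(\<lambda>x. f x + g x) \<in> L2_space M"
proof -
  have m: "f \<in> borel_measurable M" "g \<in> borel_measurable M"
    and i: "integrable M (\<lambda>x. (norm (f x))\<^sup>2)" "integrable M (\<lambda>x. (norm (g x))\<^sup>2)"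
    using assms by (auto simp: L2_space_def)
  have "integrable M (\<lambda>x. (norm (f x + g x))\<^sup>2)"
  proof (rule Bochner_Integration.integrable_bound)
    show "integrable M (\<lambda>x. 2 * (norm (f x))\<^sup>2 + 2 * (norm (g x))\<^sup>2)"
      using i by simp
    show "(\<lambda>x. (norm (f x + g x))\<^sup>2) \<in> borel_measurable M" using m by measurable
  qed (auto simp: norm_add_power2_le)
  with m show ?thesis by (simp add: L2_space_def)
qed

lemma L2_space_scale:
  assumes "f \<in> L2_space M"
  shows "(\<lambda>x. c * f x) \<in> L2_space M"
  using assms by (auto simp: L2_space_def norm_mult power_mult_distrib intro!: borel_measurable_times)

lemma L2_space_bounded:
  assumes "finite_measure M" "f \<in> borel_measurable M" "\<And>x. x \<in> space M \<Longrightarrow> norm (f x) \<le> C"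
  shows "f \<in> L2_space M" "L2_norm M f \<le> C * sqrt (measure M (space M))"
proof -
  interpret finite_measure M by fact
  have int: "integrable M (\<lambda>x. (norm (f x))\<^sup>2)"
    using assms(2,3) by (intro integrable_const_bound[of _ "C\<^sup>2"]) (auto intro!: AE_I2 power_mono)
  with assms(2) show "f \<in> L2_space M" by (simp add: L2_space_def)
  show "L2_norm M f \<le> C * sqrt (measure M (space M))"
  proof (cases "space M = {}")
    case True
    then show ?thesis by (simp add: L2_norm_def Bochner_Integration.integral_empty)
  next
    case False
    then have "C \<ge> 0" using assms(3) norm_ge_zero order_trans by blast
    have "(\<integral>x. (norm (f x))\<^sup>2 \<partial>M) \<le> (\<integral>x. C\<^sup>2 \<partial>M)"
      using int assms(3) by (intro integral_mono) (auto intro!: power_mono)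
    then have "L2_norm M f \<le> sqrt (measure M (space M) * C\<^sup>2)"
      unfolding L2_norm_def by simp
    then show ?thesis using \<open>C \<ge> 0\<close> by (simp add: real_sqrt_mult mult.commute)
  qed
qed

text \<open>The inequality is the Cauchy-Schwarz inequality against the constant function. It holds because the quadratic
  polynomial \<open>t \<mapsto> \<integral>(\<bar>f\<bar> - t)\<^sup>2\<close> has no negative value.\<close>
lemma L2_imp_integrable:
  assumes "finite_measure M" "f \<in> L2_space M"
  shows "integrable M f" "(\<integral>x. norm (f x) \<partial>M) \<le> sqrt (measure M (space M)) * L2_norm M f"
proof -
  interpret finite_measure M by fact
  have m: "f \<in> borel_measurable M" and i: "integrable M (\<lambda>x. (norm (f x))\<^sup>2)"
    using assms by (auto simp: L2_space_def)
  show int: "integrable M f"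
  proof (rule Bochner_Integration.integrable_bound)
    show "integrable M (\<lambda>x. 1 + (norm (f x))\<^sup>2)" using i by simp
    have "t \<le> 1 + t\<^sup>2" for t :: real
    proof -
      have "2 * t \<le> 1 + t\<^sup>2" using zero_le_power2[of "t - 1"] by (simp add: power2_diff)
      moreover have "0 \<le> t\<^sup>2" by simp
      ultimately show ?thesis by linarith
    qed
    then show "AE x in M. norm (f x) \<le> norm (1 + (norm (f x))\<^sup>2)" by (intro AE_I2) (auto simp: abs_of_nonneg)
  qed (rule m)
  define A N L where "A = (\<integral>x. norm (f x) \<partial>M)" and "N = (\<integral>x. (norm (f x))\<^sup>2 \<partial>M)"
    and "L = measure M (space M)"
  have A: "(\<integral>x. (norm (f x) - t)\<^sup>2 \<partial>M) = N - 2 * t * A + L * t\<^sup>2" for t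
  proof -
    have "(\<integral>x. (norm (f x) - t)\<^sup>2 \<partial>M) = (\<integral>x. (norm (f x))\<^sup>2 - 2 * t * norm (f x) + t\<^sup>2 \<partial>M)"
      by (intro Bochner_Integration.integral_cong) (auto simp: power2_diff mult.commute mult.left_commute)
    also have "\<dots> = N - 2 * t * A + L * t\<^sup>2"
      using i int by (simp add: A_def N_def L_def)
    finally show ?thesis .
  qed
  \<comment> \<open>the decisive value is \<open>t = A / L\<close>, where the polynomial is smallest\<close>
  have pos: "0 \<le> N - 2 * t * A + L * t\<^sup>2" for t
    unfolding A[symmetric] by simp
  have "L \<ge> 0" "N \<ge> 0" "A \<ge> 0" by (simp_all add: L_def N_def A_def)
  have "A\<^sup>2 \<le> L * N"
  proof (cases "L = 0")
    case True
    have "A = 0"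
    proof (rule ccontr)
      assume "A \<noteq> 0"
      with pos[of "(N + 1) / (2 * A)"] True show False by simp
    qed
    then show ?thesis using True by simp
  next
    case False
    with \<open>L \<ge> 0\<close> pos[of "A / L"] show ?thesis
      by (simp add: field_simps power2_eq_square)
  qed
  then have "A \<le> sqrt (L * N)" using real_le_rsqrt by blast
  then show "(\<integral>x. norm (f x) \<partial>M) \<le> sqrt (measure M (space M)) * L2_norm M f"
    by (simp add: A_def L_def N_def L2_norm_def real_sqrt_mult)
qed

lemma L2_dominated_convergence:
  fixes f :: "nat \<Rightarrow> 'a \<Rightarrow> complex"
  assumes f: "\<And>n. f n \<in> borel_measurable M" and h: "h \<in> borel_measurable M"
    and w: "integrable M w" and le: "\<And>n x. x \<in> space M \<Longrightarrow> (norm (h x - f n x))\<^sup>2 \<le> w x"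
    and lim: "AE x in M. (\<lambda>n. f n x) \<longlonglongrightarrow> h x" and "\<epsilon> > 0"
  obtains n where "(\<integral>x. (norm (h x - f n x))\<^sup>2 \<partial>M) < \<epsilon>"
proof -
  have "(\<lambda>n. \<integral>x. (norm (h x - f n x))\<^sup>2 \<partial>M) \<longlonglongrightarrow> (\<integral>x. 0 \<partial>M)"
  proof (rule integral_dominated_convergence[OF _ _ w])
    show "(\<lambda>x. (norm (h x - f n x))\<^sup>2) \<in> borel_measurable M" for n
    proof -
      have "(\<lambda>x. h x - f n x) \<in> borel_measurable M" by (rule borel_measurable_diff[OF h f])
      then show ?thesis by measurable
    qed
    show "AE x in M. (\<lambda>n. (norm (h x - f n x))\<^sup>2) \<longlonglongrightarrow> 0"
      using lim
    proof eventually_elim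
      case (elim x)
      then have "(\<lambda>n. (norm (h x - f n x))\<^sup>2) \<longlonglongrightarrow> (norm (h x - h x))\<^sup>2"
        by (intro tendsto_intros)
      then show ?case by simp
    qed
    show "AE x in M. norm ((norm (h x - f n x))\<^sup>2) \<le> w x" for n
      using le by (intro AE_I2) auto
  qed simp
  then have "\<forall>\<^sub>F n in sequentially. (\<integral>x. (norm (h x - f n x))\<^sup>2 \<partial>M) < \<epsilon>"
    using \<open>\<epsilon> > 0\<close> by (intro order_tendstoD) auto
  then show thesis using that by (auto simp: eventually_sequentially)
qed

text \<open>First truncate \<open>h\<close> to a bounded function. A measurable function is an almost everywhere limit of
  continuous functions; retracting these to a ball and multiplying them by cutoffs that vanish
  on \<open>Z\<close> and tend to one off \<open>Z\<close> keeps them bounded, so that dominated convergence gives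
  convergence in the mean square.\<close>
lemma continuous_vanishing_dense_L2:
  fixes h :: "real \<Rightarrow> complex"
  assumes S: "S \<in> lmeasurable" and h: "h \<in> L2_space (lebesgue_on S)"
    and Z: "closed Z" "Z \<noteq> {}" "negligible Z" and "\<epsilon> > 0"
  obtains G where "continuous_on UNIV G" "\<And>x. x \<in> Z \<Longrightarrow> G x = 0"
    "(\<lambda>x. h x - G x) \<in> L2_space (lebesgue_on S)"
    "(\<integral>x. (norm (h x - G x))\<^sup>2 \<partial>lebesgue_on S) < \<epsilon>"
proof -
  let ?M = "lebesgue_on S"
  have Ss: "S \<in> sets lebesgue" using S by (rule fmeasurableD)
  interpret finite_measure ?M
    using S by (auto intro!: finite_measureI simp: emeasure_restrict_space fmeasurable_def)
  have m: "h \<in> borel_measurable ?M" and i: "integrable ?M (\<lambda>x. (norm (h x))\<^sup>2)"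
    using h by (auto simp: L2_space_def)
  define t where "t n x = (if norm (h x) \<le> real n then h x else 0)" for n x
  have tm: "t n \<in> borel_measurable ?M" for n
    unfolding t_def using m by measurable
  obtain n where n: "(\<integral>x. (norm (h x - t n x))\<^sup>2 \<partial>?M) < \<epsilon> / 4"
  proof (rule L2_dominated_convergence[OF tm m i, where \<epsilon>="\<epsilon> / 4"])
    show "(norm (h x - t n x))\<^sup>2 \<le> (norm (h x))\<^sup>2" for n x by (simp add: t_def)
    show "AE x in ?M. (\<lambda>n. t n x) \<longlonglongrightarrow> h x"
    proof (rule AE_I2, rule tendsto_eventually)
      show "\<forall>\<^sub>F n in sequentially. t n x = h x" for x
        using eventually_ge_at_top[of "nat \<lceil>norm (h x)\<rceil>"]
        by eventually_elim (auto simp: t_def nat_le_iff ceiling_le_iff)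
    qed
  qed (use \<open>\<epsilon> > 0\<close> in auto)
  have "t n measurable_on S"
    using tm Ss by (simp add: measurable_on_iff_borel_measurable)
  then obtain N g where N: "negligible N" and g: "\<And>k. continuous_on UNIV (g k)"
      "\<And>x. x \<notin> N \<Longrightarrow> (\<lambda>k. g k x) \<longlonglongrightarrow> (if x \<in> S then t n x else 0)"
    unfolding measurable_on_def by blast
  \<comment> \<open>the retraction to the ball keeps the approximants bounded and fixes the values of \<open>t n\<close>\<close>
  define c where "c = closest_point (cball (0::complex) (real n))"
  have cc: "continuous_on UNIV c" unfolding c_def
    by (rule continuous_on_closest_point) auto
  have cn: "norm (c w) \<le> real n" for w
    using closest_point_in_set[of "cball (0::complex) (real n)" w] by (simp add: c_def)
  define G where "G k x = min 1 (real k * infdist x Z) *\<^sub>R c (g k x)" for k x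
  have Gc: "continuous_on UNIV (G k)" for k
    unfolding G_def using continuous_on_compose2[OF cc g(1)]
    by (intro continuous_intros) auto
  then have Gm: "G k \<in> borel_measurable ?M" for k
    by (intro continuous_imp_measurable_on_sets_lebesgue Ss) (auto intro: continuous_on_subset)
  have G0: "G k x = 0" if "x \<in> Z" for k x
    using that by (simp add: G_def)
  have Gn: "norm (G k x) \<le> real n" for k x
  proof -
    have "norm (G k x) = min 1 (real k * infdist x Z) * norm (c (g k x))"
      by (simp add: G_def infdist_nonneg)
    also have "\<dots> \<le> 1 * real n"
      using cn by (intro mult_mono) (auto simp: infdist_nonneg)
    finally show ?thesis by simp
  qed
  obtain k where k: "(\<integral>x. (norm (t n x - G k x))\<^sup>2 \<partial>?M) < \<epsilon> / 4"
  proof (rule L2_dominated_convergence[OF Gm tm, where w="\<lambda>_. (2 * real n)\<^sup>2" and \<epsilon>="\<epsilon> / 4"])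
    show "(norm (t n x - G k x))\<^sup>2 \<le> (2 * real n)\<^sup>2" for k x
    proof (rule power_mono)
      have "norm (t n x - G k x) \<le> norm (t n x) + norm (G k x)" by (rule norm_triangle_ineq4)
      also have "norm (t n x) \<le> real n" by (simp add: t_def)
      finally show "norm (t n x - G k x) \<le> 2 * real n" using Gn[of k x] by simp
    qed simp
    have "negligible (N \<union> Z)" using N Z by simp
    moreover have "(\<lambda>k. G k x) \<longlonglongrightarrow> t n x" if x: "x \<in> S" "x \<notin> N \<union> Z" for x
    proof -
      have pos: "infdist x Z > 0"
        using Z x in_closed_iff_infdist_zero[OF Z(1,2)] infdist_nonneg[of x Z] by (auto simp: less_le)
      have "\<forall>\<^sub>F k in sequentially. min 1 (real k * infdist x Z) = 1"
        using eventually_ge_at_top[of "nat \<lceil>1 / infdist x Z\<rceil>"]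
        by eventually_elim (use pos in \<open>auto simp: min_def field_simps nat_le_iff ceiling_le_iff\<close>)
      then have "(\<lambda>k. min 1 (real k * infdist x Z)) \<longlonglongrightarrow> 1"
        by (rule tendsto_eventually)
      moreover have "(\<lambda>k. c (g k x)) \<longlonglongrightarrow> c (t n x)"
        using g(2)[of x] x cc
        by (intro continuous_on_tendsto_compose[OF cc]) auto
      moreover have "c (t n x) = t n x"
        unfolding c_def by (rule closest_point_self) (simp add: t_def)
      ultimately have "(\<lambda>k. min 1 (real k * infdist x Z) *\<^sub>R c (g k x)) \<longlonglongrightarrow> 1 *\<^sub>R t n x"
        by (intro tendsto_scaleR) auto
      then show ?thesis by (simp add: G_def)
    qed
    ultimately show "AE x in ?M. (\<lambda>k. G k x) \<longlonglongrightarrow> t n x"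
      using Ss by (subst AE_restrict_space_iff) 
         (auto simp: eventually_ae_filter negligible_iff_null_sets intro!: bexI[of _ "N \<union> Z"])
  qed (use \<open>\<epsilon> > 0\<close> in auto)
  have L: "(\<lambda>x. h x - t n x) \<in> L2_space ?M" "(\<lambda>x. t n x - G k x) \<in> L2_space ?M"
  proof -
    have "t n \<in> L2_space ?M"
      by (rule L2_space_bounded(1)[OF finite_measure_axioms tm, of _ "real n"]) (simp add: t_def)
    moreover have "G k \<in> L2_space ?M"
      by (rule L2_space_bounded(1)[OF finite_measure_axioms Gm Gn])
    ultimately show "(\<lambda>x. h x - t n x) \<in> L2_space ?M" "(\<lambda>x. t n x - G k x) \<in> L2_space ?M"
      using L2_space_add[OF h L2_space_scale[of "t n" ?M "-1"]]
        L2_space_add[of "t n" ?M "\<lambda>x. -1 * G k x"] L2_space_scale[of "G k" ?M "-1"] by auto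
  qed
  show thesis
  proof (rule that[OF Gc G0])
    show LG: "(\<lambda>x. h x - G k x) \<in> L2_space ?M"
      using L2_space_add[OF L] by simp
    have "(\<integral>x. (norm (h x - G k x))\<^sup>2 \<partial>?M)
        \<le> (\<integral>x. 2 * (norm (h x - t n x))\<^sup>2 + 2 * (norm (t n x - G k x))\<^sup>2 \<partial>?M)"
    proof (rule integral_mono)
      show "(norm (h x - G k x))\<^sup>2 \<le> 2 * (norm (h x - t n x))\<^sup>2 + 2 * (norm (t n x - G k x))\<^sup>2" for x
        using norm_add_power2_le[of "h x - t n x" "t n x - G k x"] by simp
    qed (use LG L in \<open>auto simp: L2_space_def\<close>)
    also have "\<dots> = 2 * (\<integral>x. (norm (h x - t n x))\<^sup>2 \<partial>?M) + 2 * (\<integral>x. (norm (t n x - G k x))\<^sup>2 \<partial>?M)"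
      using L by (simp add: L2_space_def)
    finally show "(\<integral>x. (norm (h x - G k x))\<^sup>2 \<partial>?M) < \<epsilon>"
      using n k by simp
  qed
qed

lemma AE_lebesgue_on_iff_negligible:
  assumes "S \<in> sets lebesgue"
  shows "(AE x in lebesgue_on S. P x) \<longleftrightarrow> (\<exists>N. negligible N \<and> (\<forall>x\<in>S - N. P x))"
proof
  assume "AE x in lebesgue_on S. P x"
  then have "AE x in lebesgue. x \<in> S \<longrightarrow> P x"
    using assms by (simp add: AE_restrict_space_iff)
  then obtain N where "N \<in> null_sets lebesgue" "{x \<in> space lebesgue. \<not> (x \<in> S \<longrightarrow> P x)} \<subseteq> N"
    by (auto simp: eventually_ae_filter)
  then show "\<exists>N. negligible N \<and> (\<forall>x\<in>S - N. P x)"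
    by (intro exI[of _ N]) (auto simp: negligible_iff_null_sets)
next
  assume "\<exists>N. negligible N \<and> (\<forall>x\<in>S - N. P x)"
  then obtain N where "N \<in> null_sets lebesgue" "\<forall>x\<in>S - N. P x"
    by (auto simp: negligible_iff_null_sets)
  then have "AE x in lebesgue. x \<in> S \<longrightarrow> P x"
    by (auto simp: eventually_ae_filter intro!: bexI[of _ N])
  then show "AE x in lebesgue_on S. P x"
    using assms by (simp add: AE_restrict_space_iff)
qed

lemma L2_space_spike:
  assumes "S \<in> sets lebesgue" "f \<in> L2_space (lebesgue_on S)" "negligible N" "\<And>x. x \<in> S - N \<Longrightarrow> g x = f x"
  shows "g \<in> L2_space (lebesgue_on S)"
proof -
  have "f measurable_on S"
    using assms(1,2) by (simp add: L2_space_def measurable_on_iff_borel_measurable)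
  then have "g measurable_on S"
    by (rule measurable_on_spike[OF _ assms(3)]) (rule assms(4))
  then have g: "g \<in> borel_measurable (lebesgue_on S)"
    using assms(1) by (simp add: measurable_on_iff_borel_measurable)
  have "integrable (lebesgue_on S) (\<lambda>x. (norm (g x))\<^sup>2) \<longleftrightarrow> integrable (lebesgue_on S) (\<lambda>x. (norm (f x))\<^sup>2)"
  proof (rule integrable_cong_AE)
    show "(\<lambda>x. (norm (g x))\<^sup>2) \<in> borel_measurable (lebesgue_on S)" using g by measurable
    have "f \<in> borel_measurable (lebesgue_on S)" using assms(2) by (simp add: L2_space_def)
    then show "(\<lambda>x. (norm (f x))\<^sup>2) \<in> borel_measurable (lebesgue_on S)" by measurable
    show "AE x in lebesgue_on S. (norm (g x))\<^sup>2 = (norm (f x))\<^sup>2"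
      unfolding AE_lebesgue_on_iff_negligible[OF assms(1)] using assms(3,4) by auto
  qed
  with g assms(2) show ?thesis by (simp add: L2_space_def)
qed

section \<open>Laurent polynomials on the unit circle\<close>

text \<open>The linear span of a set of functions, generated one multiple at a time so that properties can be
  proved by induction.\<close>
inductive_set fun_span :: "('a \<Rightarrow> complex) set \<Rightarrow> ('a \<Rightarrow> complex) set" for E where
  zero: "(\<lambda>x. 0) \<in> fun_span E"
| step: "f \<in> E \<Longrightarrow> g \<in> fun_span E \<Longrightarrow> (\<lambda>x. c * f x + g x) \<in> fun_span E"

lemma fun_span_scaled_base: "f \<in> E \<Longrightarrow> (\<lambda>x. c * f x) \<in> fun_span E"
  using fun_span.step[OF _ fun_span.zero, of f E c] by simp

lemma fun_span_add:
  assumes "f \<in> fun_span E" "g \<in> fun_span E"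
  shows "(\<lambda>x. f x + g x) \<in> fun_span E"
  using assms(1)
proof induction
  case (step u v c)
  then show ?case using fun_span.step[of u E "\<lambda>x. v x + g x" c] by (simp add: add.assoc)
qed (use assms(2) in simp)

lemma fun_span_scale:
  assumes "f \<in> fun_span E"
  shows "(\<lambda>x. a * f x) \<in> fun_span E"
  using assms
proof induction
  case zero
  then show ?case using fun_span.zero by simp
next
  case (step u v c)
  then show ?case using fun_span.step[of u E "\<lambda>x. a * v x" "a * c"] by (simp add: algebra_simps)
qed

lemma fun_span_finite_sum:
  assumes "g \<in> fun_span E"
  shows "\<exists>F c. finite F \<and> F \<subseteq> E \<and> g = (\<lambda>x. \<Sum>f\<in>F. c f * f x)"
  using assms
proof induction
  case zero
  then show ?case by (intro exI[of _ "{}"]) auto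
next
  case (step u v a)
  then obtain F c where F: "finite F" "F \<subseteq> E" "v = (\<lambda>x. \<Sum>f\<in>F. c f * f x)" by blast
  define b where "b f = (if f = u then a else 0) + (if f \<in> F then c f else 0)" for f
  have "a * u x + v x = (\<Sum>f\<in>insert u F. b f * f x)" for x
  proof -
    have "v x = (\<Sum>f\<in>insert u F. (if f \<in> F then c f else 0) * f x)"
      unfolding F(3) using F(1) by (intro sum.mono_neutral_cong_left) auto
    moreover have "a * u x = (\<Sum>f\<in>insert u F. (if f = u then a else 0) * f x)"
      using F(1) sum.remove[of "insert u F" u "\<lambda>f. (if f = u then a else 0) * f x"] by simp
    ultimately show ?thesis by (simp only: b_def ring_distribs sum.distrib)
  qed
  with F(1,2) step.hyps(1) show ?case
    by (intro exI[of _ "insert u F"] exI[of _ b]) auto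
qed

definition Laurent_polynomials :: "(complex \<Rightarrow> complex) set" where
  "Laurent_polynomials = fun_span (range (\<lambda>n z. z powi n))"

lemma Laurent_monomial: "(\<lambda>z. c * z powi n) \<in> Laurent_polynomials"
  unfolding Laurent_polynomials_def by (rule fun_span_scaled_base) simp

lemma Laurent_polynomials_add:
  "f \<in> Laurent_polynomials \<Longrightarrow> g \<in> Laurent_polynomials \<Longrightarrow> (\<lambda>z. f z + g z) \<in> Laurent_polynomials"
  unfolding Laurent_polynomials_def by (rule fun_span_add)

lemma Laurent_polynomials_scale:
  "f \<in> Laurent_polynomials \<Longrightarrow> (\<lambda>z. a * f z) \<in> Laurent_polynomials"
  unfolding Laurent_polynomials_def by (rule fun_span_scale)

lemma Laurent_polynomials_induct [consumes 1, case_names zero step]: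
  assumes "f \<in> Laurent_polynomials" "P (\<lambda>z. 0)"
    "\<And>c n g. g \<in> Laurent_polynomials \<Longrightarrow> P g \<Longrightarrow> P (\<lambda>z. c * z powi n + g z)"
  shows "P f"
  using assms(1) unfolding Laurent_polynomials_def
proof induction
  case (step f g c)
  then show ?case using assms(3)[of g] unfolding Laurent_polynomials_def by auto
qed (rule assms(2))

lemma Laurent_polynomials_monomial_mult:
  assumes "f \<in> Laurent_polynomials"
  shows "\<exists>h\<in>Laurent_polynomials. \<forall>z. z \<noteq> 0 \<longrightarrow> h z = z powi m * f z"
  using assms
proof (induction rule: Laurent_polynomials_induct)
  case zero
  show ?case using Laurent_monomial[of 0 0] by (intro bexI) auto
next
  case (step c n g)
  then obtain h where h: "h \<in> Laurent_polynomials" "\<forall>z. z \<noteq> 0 \<longrightarrow> h z = z powi m * g z" by blast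
  have "(\<lambda>z. c * z powi (m + n) + h z) \<in> Laurent_polynomials"
    by (intro Laurent_polynomials_add Laurent_monomial h(1))
  then show ?case
    by (rule bexI[rotated]) (auto simp: h(2) power_int_add algebra_simps)
qed

text \<open>The product formula is restricted to \<open>z \<noteq> 0\<close> because \<open>0 powi n\<close> breaks the law of exponents.\<close>
lemma Laurent_polynomials_mult:
  assumes "f \<in> Laurent_polynomials" "g \<in> Laurent_polynomials"
  shows "\<exists>h\<in>Laurent_polynomials. \<forall>z. z \<noteq> 0 \<longrightarrow> h z = f z * g z"
  using assms(1)
proof (induction rule: Laurent_polynomials_induct)
  case zero
  show ?case using Laurent_monomial[of 0 0] by (intro bexI) auto
next
  case (step c n f)
  then obtain h where h: "h \<in> Laurent_polynomials" "\<forall>z. z \<noteq> 0 \<longrightarrow> h z = f z * g z" by blast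
  obtain k where k: "k \<in> Laurent_polynomials" "\<forall>z. z \<noteq> 0 \<longrightarrow> k z = z powi n * g z"
    using Laurent_polynomials_monomial_mult[OF assms(2)] by blast
  have "(\<lambda>z. c * k z + h z) \<in> Laurent_polynomials"
    by (intro Laurent_polynomials_add Laurent_polynomials_scale h(1) k(1))
  then show ?case
    by (rule bexI[rotated]) (auto simp: h(2) k(2) algebra_simps)
qed

text \<open>On the unit circle the conjugate of \<open>z\<close> is \<open>1 / z\<close>, so the coordinates \<open>Re z\<close> and \<open>Im z\<close>, and with them
  all polynomials in them, are Laurent polynomials in \<open>z\<close>.\<close>
lemma real_polynomial_function_on_circle:
  assumes "real_polynomial_function p"
  shows "\<exists>q\<in>Laurent_polynomials. \<forall>z\<in>sphere 0 1. q z = complex_of_real (p z)"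
  using assms
proof (induction p rule: real_polynomial_function.induct)
  case (linear f)
  then interpret bounded_linear f .
  let ?A = "complex_of_real (f 1)" and ?B = "complex_of_real (f \<i>)"
  \<comment> \<open>\<open>Re z = (z + 1 / z) / 2\<close> and \<open>Im z = (z - 1 / z) / (2 \<i>)\<close>\<close>
  define q where "q = (\<lambda>z::complex. ((?A - \<i> * ?B) / 2) * z powi 1 + ((?A + \<i> * ?B) / 2) * z powi (-1))"
  have "q \<in> Laurent_polynomials"
    unfolding q_def by (intro Laurent_polynomials_add Laurent_monomial)
  moreover have "q z = complex_of_real (f z)" if z: "z \<in> sphere 0 1" for z
  proof -
    have "cnj z = inverse z"
      using z complex_norm_square[of z] by (simp add: inverse_unique)
    have "Re z *\<^sub>R 1 + Im z *\<^sub>R \<i> = z" by (simp add: complex_eq_iff)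
    then have "f z = f (Re z *\<^sub>R 1 + Im z *\<^sub>R \<i>)" by (simp only:)
    then have "f z = Re z * f 1 + Im z * f \<i>" by (simp only: add scaleR real_scaleR_def)
    moreover have "z powi (-1) = cnj z" using \<open>cnj z = inverse z\<close> by (simp add: power_int_minus)
    then have "q z = ((?A - \<i> * ?B) / 2) * z + ((?A + \<i> * ?B) / 2) * cnj z"
      by (simp only: q_def power_int_1_right)
    ultimately show ?thesis
      by (simp add: complex_eq_iff field_simps)
  qed
  ultimately show ?case by blast
next
  case (const c)
  have "(\<lambda>z. complex_of_real c * z powi 0) \<in> Laurent_polynomials"
    by (rule Laurent_monomial)
  then show ?case by force
next
  case (add f g)
  then obtain q r where "q \<in> Laurent_polynomials" "r \<in> Laurent_polynomials"
    "\<forall>z\<in>sphere 0 1. q z = complex_of_real (f z)" "\<forall>z\<in>sphere 0 1. r z = complex_of_real (g z)" by blast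
  then show ?case by (intro bexI[of _ "\<lambda>z. q z + r z"] Laurent_polynomials_add) auto
next
  case (mult f g)
  then obtain q r where q: "q \<in> Laurent_polynomials"
    "\<forall>z\<in>sphere 0 1. q z = complex_of_real (f z)"
    and r: "r \<in> Laurent_polynomials"
      "\<forall>z\<in>sphere 0 1. r z = complex_of_real (g z)" by blast
  obtain h where "h \<in> Laurent_polynomials" and h: "\<forall>z. z \<noteq> 0 \<longrightarrow> h z = q z * r z"
    using Laurent_polynomials_mult[OF q(1) r(1)] by blast
  moreover have "h z = complex_of_real (f z * g z)" if "z \<in> sphere 0 1" for z
  proof -
    have "z \<noteq> 0" using that by auto
    then show ?thesis using h q(2) r(2) that by simp
  qed
  ultimately show ?case by blast
qed

lemma Laurent_polynomials_dense_on_circle: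
  fixes F :: "complex \<Rightarrow> complex"
  assumes "compact K" "K \<subseteq> sphere 0 1" "continuous_on K F" "e > 0"
  obtains q where "q \<in> Laurent_polynomials" "\<And>z. z \<in> K \<Longrightarrow> norm (F z - q z) < e"
proof -
  obtain p where p: "polynomial_function p" "\<And>z. z \<in> K \<Longrightarrow> norm (F z - p z) < e"
    using Stone_Weierstrass_polynomial_function[OF assms(1,3,4)] by blast
  have "real_polynomial_function (Re \<circ> p)" "real_polynomial_function (Im \<circ> p)"
    using p(1) by (simp_all add: polynomial_function_def bounded_linear_Re bounded_linear_Im)
  then obtain q1 q2 where q: "q1 \<in> Laurent_polynomials" "q2 \<in> Laurent_polynomials"
      "\<forall>z\<in>sphere 0 1. q1 z = complex_of_real ((Re \<circ> p) z)" "\<forall>z\<in>sphere 0 1. q2 z = complex_of_real ((Im \<circ> p) z)"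
    using real_polynomial_function_on_circle by metis
  show thesis
  proof
    show "(\<lambda>z. q1 z + \<i> * q2 z) \<in> Laurent_polynomials"
      by (intro Laurent_polynomials_add Laurent_polynomials_scale q)
    fix z assume z: "z \<in> K"
    then have "q1 z + \<i> * q2 z = p z"
      using q(3,4) assms(2) complex_eq[of "p z"] by auto
    then show "norm (F z - (q1 z + \<i> * q2 z)) < e" using p(2)[OF z] by simp
  qed
qed

text \<open>A continuous map of a compact space onto its image in a Hausdorff space is a quotient map. Hence \<open>G\<close>, being constant on
  the fibres of \<open>p\<close>, factors as \<open>F \<circ> p\<close> with \<open>F\<close> continuous, and \<open>F\<close> can be approximated on the circle.\<close>
lemma Laurent_polynomials_dense_pullback:
  fixes p :: "'a::euclidean_space \<Rightarrow> complex" and G :: "'a \<Rightarrow> complex"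
  assumes S: "compact S" and p: "continuous_on S p" "p ` S \<subseteq> sphere 0 1"
    and G: "continuous_on S G" "\<And>x y. x \<in> S \<Longrightarrow> y \<in> S \<Longrightarrow> p x = p y \<Longrightarrow> G x = G y" and "e > 0"
  obtains q where "q \<in> Laurent_polynomials" "\<And>x. x \<in> S \<Longrightarrow> norm (G x - q (p x)) < e"
proof -
  have quot: "quotient_map (top_of_set S) (top_of_set (p ` S)) p"
    by (rule T1_Spaces.continuous_imp_quotient_map)
      (use S p(1) in \<open>auto simp: compact_space_subtopology Hausdorff_space_subtopology\<close>)
  have cont: "continuous_map (top_of_set S) euclidean G" using G(1) by simp
  obtain F where F: "continuous_map (top_of_set (p ` S)) euclidean F" "\<And>x. x \<in> S \<Longrightarrow> F (p x) = G x"
  proof (rule quotient_map_lift_exists[OF quot cont])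
    show "G x = G y" if "x \<in> topspace (top_of_set S)" "y \<in> topspace (top_of_set S)" "p x = p y" for x y
      using that by (intro G(2)) auto
  qed simp
  have "compact (p ` S)" using S p(1) by (rule compact_continuous_image[rotated])
  moreover have "continuous_on (p ` S) F" using F(1) by simp
  ultimately obtain q where q: "q \<in> Laurent_polynomials" "\<And>z. z \<in> p ` S \<Longrightarrow> norm (F z - q z) < e"
    by (rule Laurent_polynomials_dense_on_circle[OF _ p(2) _ \<open>e > 0\<close>]) blast
  show thesis
  proof (rule that[OF q(1)])
    fix x assume x: "x \<in> S"
    then have "norm (F (p x) - q (p x)) < e" by (intro q(2) imageI)
    then show "norm (G x - q (p x)) < e" by (simp only: F(2)[OF x])
  qed
qed

section \<open>The momentum operator with boundary condition\<close>

lemma e_fun_eq_cis: "e_fun x = cis (2 * pi * x)"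
  by (simp add: e_fun_def cis_conv_exp mult_ac)

lemma e_fun_add: "e_fun (x + y) = e_fun x * e_fun y"
  by (simp add: e_fun_eq_cis cis_mult algebra_simps)

lemma norm_e_fun [simp]: "norm (e_fun x) = 1"
  by (simp add: e_fun_eq_cis)

lemma e_fun_half: "e_fun (1/2) = -1"
  by (simp add: e_fun_eq_cis)

lemma e_fun_of_int [simp]: "e_fun (of_int n) = 1"
  by (simp add: e_fun_eq_cis cis_multiple_2pi)

locale two_intervals_momentum =
  fixes \<alpha> \<beta> \<phi> \<psi> \<theta> :: real
  assumes \<alpha>: "1 < \<alpha>" and \<alpha>\<beta>: "\<alpha> < \<beta>"
begin

abbreviation "S \<equiv> two_intervals \<alpha> \<beta>"
abbreviation "M \<equiv> lebesgue_on S"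
abbreviation "P\<^sub>B \<equiv> momentum_restriction \<alpha> \<beta> (boundary_matrix 0 \<phi> \<psi> \<theta>)"
abbreviation "len \<equiv> 1 + \<beta> - \<alpha>"

lemma S_lmeasurable: "S \<in> lmeasurable"
  by (auto simp: two_intervals_def intro!: fmeasurable.Un)

lemma S_sets [simp]: "S \<in> sets lebesgue"
  using S_lmeasurable by (rule fmeasurableD)

lemma finite_measure_M: "finite_measure M"
  using S_lmeasurable by (auto intro!: finite_measureI simp: emeasure_restrict_space fmeasurable_def)

lemma space_M [simp]: "space M = S"
  by (simp add: space_restrict_space)

lemma len_pos: "len > 0"
  using \<alpha>\<beta> by simp

lemma measure_M: "measure M S = len"
proof -
  have "measure lebesgue S = measure lebesgue {0..1::real} + measure lebesgue {\<alpha>..\<beta>}"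
    unfolding two_intervals_def using \<alpha> by (intro measure_Un_AE) auto
  then show ?thesis using \<alpha>\<beta> by (simp add: measure_restrict_space)
qed

lemma at_within_interior_S:
  assumes "x \<in> S - {0, 1, \<alpha>, \<beta>}"
  shows "at x within S = at x"
proof (rule at_within_interior)
  have "open ({0<..<1} \<union> {\<alpha><..<\<beta>})" "{0<..<1} \<union> {\<alpha><..<\<beta>} \<subseteq> S"
    by (auto simp: two_intervals_def)
  moreover have "x \<in> {0<..<1} \<union> {\<alpha><..<\<beta>}"
    using assms by (auto simp: two_intervals_def)
  ultimately show "x \<in> interior S" 
    using interior_maximal by blast
qed

lemma boundary_condition_iff:
  "boundary_matrix 0 \<phi> \<psi> \<theta> *v vector [f 1, f \<beta>] = vector [f 0, f \<alpha>] \<longleftrightarrow>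
    f 0 = - e_fun (\<theta> - \<psi>) * f \<beta> \<and> f \<alpha> = e_fun \<psi> * f 1"
  by (auto simp: boundary_matrix_def vec_eq_iff forall_2 matrix_vector_mult_def sum_2)

lemma P\<^sub>B_domain_iff:
  "f \<in> fst P\<^sub>B \<longleftrightarrow> f \<in> max_momentum_dom \<alpha> \<beta> \<and>
    f 0 = - e_fun (\<theta> - \<psi>) * f \<beta> \<and> f \<alpha> = e_fun \<psi> * f 1"
  by (simp add: momentum_restriction_def restrict_operator_def max_momentum_def boundary_condition_iff)

lemma P\<^sub>B_apply: "snd P\<^sub>B f x = interval_deriv \<alpha> \<beta> f x / (2 * pi * \<i>)"
  by (simp add: momentum_restriction_def restrict_operator_def max_momentum_def mult_ac)

text \<open>The four endpoints are put into the exceptional set: elsewhere the derivative within the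
  two intervals is an ordinary derivative.\<close>
lemma max_momentum_dom_derivative:
  assumes "f \<in> max_momentum_dom \<alpha> \<beta>"
  obtains N where "negligible N"
    "\<And>x. x \<in> S - N \<Longrightarrow> (f has_vector_derivative interval_deriv \<alpha> \<beta> f x) (at x)"
proof -
  have "AE x in M. f differentiable (at x within S)"
    using assms by (simp add: max_momentum_dom_def)
  then obtain N where N: "negligible N" "\<forall>x\<in>S - N. f differentiable (at x within S)"
    unfolding AE_lebesgue_on_iff_negligible[OF S_sets] by blast
  show thesis
  proof (rule that)
    show "negligible (N \<union> {0, 1, \<alpha>, \<beta>})" using N(1) by simp
    fix x assume x: "x \<in> S - (N \<union> {0, 1, \<alpha>, \<beta>})"
    then have "f differentiable (at x within S)" using N(2) by blast
    then have "(f has_vector_derivative vector_derivative f (at x within S)) (at x within S)"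
      by (simp add: vector_derivative_works)
    then show "(f has_vector_derivative interval_deriv \<alpha> \<beta> f x) (at x)"
      using x by (simp add: interval_deriv_def at_within_interior_S)
  qed
qed

lemma max_momentum_domI:
  assumes ac: "absolutely_continuous_fun_on f {0..1}" "absolutely_continuous_fun_on f {\<alpha>..\<beta>}"
    and N: "negligible N" and d: "\<And>x. x \<in> S - N \<Longrightarrow> (f has_vector_derivative d x) (at x)"
    and L2: "d \<in> L2_space M"
  shows "f \<in> max_momentum_dom \<alpha> \<beta>" "AE x in M. interval_deriv \<alpha> \<beta> f x = d x"
proof -
  have N': "negligible (N \<union> {0, 1, \<alpha>, \<beta>})" using N by simp
  have eq: "interval_deriv \<alpha> \<beta> f x = d x" if "x \<in> S - (N \<union> {0, 1, \<alpha>, \<beta>})" for x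
    using d[of x] that by (auto simp: interval_deriv_def at_within_interior_S intro: vector_derivative_at)
  then show "AE x in M. interval_deriv \<alpha> \<beta> f x = d x"
    unfolding AE_lebesgue_on_iff_negligible[OF S_sets] using N' by blast
  have "f differentiable (at x within S)" if "x \<in> S - N" for x
    using d[OF that] by (meson differentiableI_vector differentiable_at_withinI)
  then have "AE x in M. f differentiable (at x within S)"
    unfolding AE_lebesgue_on_iff_negligible[OF S_sets] using N by blast
  moreover have "interval_deriv \<alpha> \<beta> f \<in> L2_space M"
    using L2_space_spike[OF S_sets L2 N'] eq by blast
  ultimately show "f \<in> max_momentum_dom \<alpha> \<beta>"
    using ac by (simp add: max_momentum_dom_def)
qed

lemma L2_piecewise_bounded:
  fixes f :: "real \<Rightarrow> complex"
  assumes "continuous_on {0..1} f" "continuous_on {\<alpha>..\<beta>} f"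
  shows "f \<in> L2_space M"
proof -
  have cont: "continuous_on S f"
    unfolding two_intervals_def using assms by (intro continuous_on_closed_Un) auto
  have "compact S" by (auto simp: two_intervals_def intro!: compact_Un)
  then have "bounded (f ` S)"
    using cont by (intro compact_imp_bounded compact_continuous_image)
  then obtain C where "\<And>x. x \<in> S \<Longrightarrow> norm (f x) \<le> C"
    unfolding bounded_iff by blast
  moreover have "f \<in> borel_measurable M"
    by (rule continuous_imp_measurable_on_sets_lebesgue[OF cont S_sets])
  ultimately show ?thesis
    by (intro L2_space_bounded(1)[OF finite_measure_M]) auto
qed

section \<open>The resolvent set\<close>

lemma L2_on_subinterval:
  assumes g: "g \<in> L2_space M" and ab: "{a..b} \<subseteq> S"
  shows "g absolutely_integrable_on {a..b}"
    and "integral {a..b} (\<lambda>x. norm (g x)) \<le> (\<integral>x. norm (g x) \<partial>M)"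
proof -
  have int: "integrable M g" using L2_imp_integrable(1)[OF finite_measure_M g] .
  then have "g absolutely_integrable_on S"
    by (simp add: set_integrable_def integrable_restrict_space)
  then show gab: "g absolutely_integrable_on {a..b}"
    using ab by (rule absolutely_integrable_on_subinterval)
  have "(\<integral>x. norm (g x) \<partial>M) = integral S (\<lambda>x. norm (g x))"
    using int by (intro lebesgue_integral_eq_integral) auto
  moreover have "integral {a..b} (\<lambda>x. norm (g x)) \<le> integral S (\<lambda>x. norm (g x))"
    using gab \<open>g absolutely_integrable_on S\<close> ab
    by (intro integral_subset_le) (auto simp: absolutely_integrable_on_def)
  ultimately show "integral {a..b} (\<lambda>x. norm (g x)) \<le> (\<integral>x. norm (g x) \<partial>M)" by simp
qed

lemma norm_exp_le:
  assumes "\<bar>x\<bar> \<le> \<beta>"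
  shows "norm (exp (\<kappa> * complex_of_real x)) \<le> exp (norm \<kappa> * \<beta>)"
proof -
  have "norm (exp (\<kappa> * complex_of_real x)) \<le> exp (norm (\<kappa> * complex_of_real x))"
    by (rule norm_exp)
  also have "\<dots> \<le> exp (norm \<kappa> * \<beta>)"
    using assms by (auto simp: norm_mult intro!: mult_left_mono)
  finally show ?thesis .
qed

text \<open>Variation of constants on one of the two intervals, with \<open>2 \<pi> \<i> (P f - z f)\<close> as the inhomogeneity:
  the deviation of \<open>f\<close> from the solution of the homogeneous equation is bounded by the \<open>L\<^sup>1\<close> norm of
  \<open>P f - z f\<close>.\<close>
lemma domain_propagation:
  fixes z :: complex
  assumes f: "f \<in> max_momentum_dom \<alpha> \<beta>" and ab: "{a..b} \<subseteq> S" and x: "x \<in> {a..b}"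
    and ac: "absolutely_continuous_fun_on f {a..b}"
  defines "\<kappa> \<equiv> 2 * pi * \<i> * z" and "g \<equiv> \<lambda>x. snd P\<^sub>B f x - z * f x"
  assumes g: "g \<in> L2_space M"
  shows "norm (exp (- \<kappa> * of_real x) * f x - exp (- \<kappa> * of_real a) * f a)
    \<le> exp (norm \<kappa> * \<beta>) * (2 * pi) * (\<integral>x. norm (g x) \<partial>M)"
proof -
  obtain N where N: "negligible N"
    "\<And>x. x \<in> S - N \<Longrightarrow> (f has_vector_derivative interval_deriv \<alpha> \<beta> f x) (at x)"
    using max_momentum_dom_derivative[OF f] by blast
  have deriv: "(f has_vector_derivative \<kappa> * f t + 2 * pi * \<i> * g t) (at t within {a..b})"
    if "t \<in> {a..b} - N" for t
  proof -
    have "interval_deriv \<alpha> \<beta> f t = \<kappa> * f t + 2 * pi * \<i> * g t"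
      by (simp add: g_def P\<^sub>B_apply \<kappa>_def field_simps)
    moreover have "t \<in> S - N" using that ab by auto
    ultimately show ?thesis
      using has_vector_derivative_at_within[OF N(2)[of t]] by simp
  qed
  have int: "((\<lambda>t. exp (- \<kappa> * of_real t) * (2 * pi * \<i> * g t)) has_integral
      exp (- \<kappa> * of_real x) * f x - exp (- \<kappa> * of_real a) * f a) {a..x}"
    by (rule variation_of_constants[OF ac N(1) deriv x])
  have ax: "{a..x} \<subseteq> S" using ab x by auto
  have gi: "(\<lambda>t. norm (g t)) integrable_on {a..x}"
    using L2_on_subinterval(1)[OF g ax] by (simp add: absolutely_integrable_on_def)
  let ?D = "exp (norm \<kappa> * \<beta>)"
  have "norm (integral {a..x} (\<lambda>t. exp (- \<kappa> * of_real t) * (2 * pi * \<i> * g t)))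
      \<le> integral {a..x} (\<lambda>t. ?D * (2 * pi) * norm (g t))"
  proof (rule Henstock_Kurzweil_Integration.integral_norm_bound_integral)
    show "(\<lambda>t. exp (- \<kappa> * of_real t) * (2 * pi * \<i> * g t)) integrable_on {a..x}"
      using int by (rule has_integral_integrable)
    show "(\<lambda>t. ?D * (2 * pi) * norm (g t)) integrable_on {a..x}"
      using gi by (rule integrable_on_mult_right)
    fix t assume "t \<in> {a..x}"
    then have "\<bar>t\<bar> \<le> \<beta>" using ax \<alpha> \<alpha>\<beta> by (auto simp: two_intervals_def subset_iff)
    then have "norm (exp (- \<kappa> * of_real t)) \<le> ?D"
      using norm_exp_le[of t "- \<kappa>"] by simp
    then have "norm (exp (- \<kappa> * of_real t)) * (2 * pi * norm (g t)) \<le> ?D * (2 * pi * norm (g t))"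
      by (rule mult_right_mono) simp
    then show "norm (exp (- \<kappa> * of_real t) * (2 * pi * \<i> * g t)) \<le> ?D * (2 * pi) * norm (g t)"
      by (simp add: norm_mult mult_ac)
  qed
  also have "\<dots> = ?D * (2 * pi) * integral {a..x} (\<lambda>t. norm (g t))"
    by simp
  also have "\<dots> \<le> ?D * (2 * pi) * (\<integral>x. norm (g x) \<partial>M)"
    using L2_on_subinterval(2)[OF g ax] by (intro mult_left_mono) auto
  finally show ?thesis using integral_unique[OF int] by simp
qed

lemma P\<^sub>B_minus_z_in_L2:
  assumes f: "f \<in> max_momentum_dom \<alpha> \<beta>"
  shows "f \<in> L2_space M" "(\<lambda>x. snd P\<^sub>B f x - z * f x) \<in> L2_space M"
proof -
  have "continuous_on {0..1} f" "continuous_on {\<alpha>..\<beta>} f" "interval_deriv \<alpha> \<beta> f \<in> L2_space M"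
    using f by (auto simp: max_momentum_dom_def intro: absolutely_continuous_imp_continuous_on)
  then show fL: "f \<in> L2_space M" by (intro L2_piecewise_bounded)
  have "(\<lambda>x. 1 / (2 * pi * \<i>) * interval_deriv \<alpha> \<beta> f x + - z * f x) \<in> L2_space M"
    by (intro L2_space_add L2_space_scale fL) fact
  then show "(\<lambda>x. snd P\<^sub>B f x - z * f x) \<in> L2_space M"
    by (simp add: P\<^sub>B_apply)
qed

text \<open>The same estimate for the two intervals, solved for \<open>f x\<close>. With \<open>P f = z f\<close> the bound is zero and the
  lemma describes the eigenfunctions; otherwise it bounds the inverse of \<open>P\<^sub>B - z\<close>.\<close>
lemma domain_propagation_bound:
  fixes z :: complex
  assumes f: "f \<in> max_momentum_dom \<alpha> \<beta>"
  defines "\<kappa> \<equiv> 2 * pi * \<i> * z"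
  defines "C \<equiv> 2 * pi * (exp (norm \<kappa> * \<beta>))\<^sup>2 * (\<integral>x. norm (snd P\<^sub>B f x - z * f x) \<partial>M)"
  shows "x \<in> {0..1} \<Longrightarrow> norm (f x - exp (\<kappa> * of_real x) * f 0) \<le> C"
    and "x \<in> {\<alpha>..\<beta>} \<Longrightarrow> norm (f x - exp (\<kappa> * of_real (x - \<alpha>)) * f \<alpha>) \<le> C"
proof -
  have gen: "norm (f x - exp (\<kappa> * of_real (x - a)) * f a) \<le> C"
    if x: "x \<in> {a..b}" and ab: "{a..b} \<subseteq> S" and ac: "absolutely_continuous_fun_on f {a..b}" for a b x
  proof -
    have "\<bar>x\<bar> \<le> \<beta>" using x ab \<alpha> \<alpha>\<beta> by (auto simp: two_intervals_def)
    have "f x - exp (\<kappa> * of_real (x - a)) * f a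
        = exp (\<kappa> * of_real x) * (exp (- \<kappa> * of_real x) * f x - exp (- \<kappa> * of_real a) * f a)"
      by (simp add: algebra_simps flip: exp_add mult.assoc)
    also have "norm \<dots> \<le> exp (norm \<kappa> * \<beta>) * (exp (norm \<kappa> * \<beta>) * (2 * pi)
        * (\<integral>x. norm (snd P\<^sub>B f x - z * f x) \<partial>M))"
      unfolding norm_mult
      using norm_exp_le[OF \<open>\<bar>x\<bar> \<le> \<beta>\<close>, of \<kappa>]
        domain_propagation[OF f ab x ac P\<^sub>B_minus_z_in_L2(2)[OF f, of z], folded \<kappa>_def]
      by (intro mult_mono) auto
    finally show ?thesis by (simp add: C_def power2_eq_square mult_ac)
  qed
  have ac: "absolutely_continuous_fun_on f {0..1}" "absolutely_continuous_fun_on f {\<alpha>..\<beta>}"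
    using f by (auto simp: max_momentum_dom_def)
  show "x \<in> {0..1} \<Longrightarrow> norm (f x - exp (\<kappa> * of_real x) * f 0) \<le> C"
    using gen[of x 0 1] ac by (auto simp: two_intervals_def)
  show "x \<in> {\<alpha>..\<beta>} \<Longrightarrow> norm (f x - exp (\<kappa> * of_real (x - \<alpha>)) * f \<alpha>) \<le> C"
    using gen[of x \<alpha> \<beta>] ac by (auto simp: two_intervals_def)
qed

text \<open>Going once around the circle, \<open>(1 + e(\<theta>) exp (\<kappa> (1 + \<beta> - \<alpha>))) f 0\<close> is a combination of the deviations on the two
  intervals. So \<open>f 0\<close>, and then all of \<open>f\<close>, is bounded by the \<open>L\<^sup>1\<close> norm of \<open>P f - z f\<close>, hence by its
  \<open>L\<^sup>2\<close> norm.\<close>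
lemma resolvent_lower_bound:
  fixes z :: complex
  defines "\<kappa> \<equiv> 2 * pi * \<i> * z"
  assumes nz: "1 + e_fun \<theta> * exp (\<kappa> * of_real len) \<noteq> 0"
  shows "\<exists>C. \<forall>f\<in>fst P\<^sub>B. L2_norm M f \<le> C * L2_norm M (\<lambda>x. snd P\<^sub>B f x - z * f x)"
proof -
  define D where "D = exp (norm \<kappa> * \<beta>)"
  define E where "E = norm (1 + e_fun \<theta> * exp (\<kappa> * of_real len))"
  have "E > 0" using nz by (simp add: E_def)
  have "D \<ge> 1" using \<alpha> \<alpha>\<beta> by (simp add: D_def)
  define K where "K = (D\<^sup>2 * (1 + D) / E + D + 1) * (2 * pi * D\<^sup>2)"
  have "L2_norm M f \<le> (K * len) * L2_norm M (\<lambda>x. snd P\<^sub>B f x - z * f x)" if f: "f \<in> fst P\<^sub>B" for f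
  proof -
    have dom: "f \<in> max_momentum_dom \<alpha> \<beta>"
      and bc: "f 0 = - e_fun (\<theta> - \<psi>) * f \<beta>" "f \<alpha> = e_fun \<psi> * f 1"
      using f by (auto simp: P\<^sub>B_domain_iff)
    define A where "A = (\<integral>x. norm (snd P\<^sub>B f x - z * f x) \<partial>M)"
    define C where "C = 2 * pi * D\<^sup>2 * A"
    have "A \<ge> 0" by (simp add: A_def)
    then have "C \<ge> 0" by (simp add: C_def)
    have I1: "norm (f x - exp (\<kappa> * of_real x) * f 0) \<le> C" if "x \<in> {0..1}" for x
      using domain_propagation_bound(1)[OF dom that, of z] by (simp add: C_def D_def A_def \<kappa>_def)
    have I2: "norm (f x - exp (\<kappa> * of_real (x - \<alpha>)) * f \<alpha>) \<le> C" if "x \<in> {\<alpha>..\<beta>}" for x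
      using domain_propagation_bound(2)[OF dom that, of z] by (simp add: C_def D_def A_def \<kappa>_def)
    have expD: "norm (exp (\<kappa> * of_real x)) \<le> D" if "\<bar>x\<bar> \<le> \<beta>" for x
      using norm_exp_le[OF that] by (simp add: D_def)
    have f1: "norm (f 1 - exp \<kappa> * f 0) \<le> C" using I1[of 1] by simp
    have f\<beta>: "norm (f \<beta> - exp (\<kappa> * of_real (\<beta> - \<alpha>)) * f \<alpha>) \<le> C" using I2[of \<beta>] \<alpha>\<beta> by simp
    have "f 0 * (1 + e_fun \<theta> * exp (\<kappa> * of_real len))
        = - e_fun (\<theta> - \<psi>) * ((f \<beta> - exp (\<kappa> * of_real (\<beta> - \<alpha>)) * f \<alpha>)
          + exp (\<kappa> * of_real (\<beta> - \<alpha>)) * e_fun \<psi> * (f 1 - exp \<kappa> * f 0))"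
    proof -
      have e: "e_fun \<theta> = e_fun (\<theta> - \<psi>) * e_fun \<psi>" by (simp flip: e_fun_add)
      have x: "exp (\<kappa> * of_real len) = exp (\<kappa> * of_real (\<beta> - \<alpha>)) * exp \<kappa>"
        by (simp add: algebra_simps flip: exp_add)
      have "f0 * (1 + (u * v) * (a * k)) = - u * ((fb - a * fa) + a * v * (f1 - k * f0))"
        if "f0 = - u * fb" "fa = v * f1" for u v a k f0 fb fa f1 :: complex
      proof -
        have "- u * ((fb - a * fa) + a * v * (f1 - k * f0)) = - u * fb + u * v * (a * k) * f0"
          unfolding that(2) by (simp add: algebra_simps)
        also have "\<dots> = f0 + u * v * (a * k) * f0" by (simp only: that(1)[symmetric])
        finally show ?thesis by (simp add: algebra_simps)
      qed
      from this[OF bc] show ?thesis unfolding e x .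
    qed
    also have "norm \<dots> \<le> C + D * C"
    proof -
      have "norm (exp (\<kappa> * of_real (\<beta> - \<alpha>)) * e_fun \<psi> * (f 1 - exp \<kappa> * f 0)) \<le> D * C"
        unfolding norm_mult norm_e_fun mult_1_right
        using f1 expD[of "\<beta> - \<alpha>"] \<alpha> \<alpha>\<beta> \<open>D \<ge> 1\<close> by (intro mult_mono) auto
      moreover have "norm (- e_fun t * w) = norm w" for t w by (simp add: norm_mult)
      ultimately show ?thesis
        using f\<beta> by (simp only:) (intro order_trans[OF norm_triangle_ineq] add_mono)
    qed
    finally have "norm (f 0) * E \<le> C + D * C"
      by (simp only: norm_mult E_def)
    then have f0: "norm (f 0) \<le> (1 + D) * C / E"
      using \<open>E > 0\<close> by (simp add: pos_le_divide_eq ring_distribs)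
    have b1: "norm (f x) \<le> D * norm (f 0) + C" if x: "x \<in> {0..1}" for x
    proof -
      have "norm (f x) \<le> norm (exp (\<kappa> * of_real x) * f 0) + norm (f x - exp (\<kappa> * of_real x) * f 0)"
        using norm_triangle_ineq[of "exp (\<kappa> * of_real x) * f 0" "f x - exp (\<kappa> * of_real x) * f 0"] by simp
      also have "\<dots> \<le> D * norm (f 0) + C"
        unfolding norm_mult using x \<alpha> \<alpha>\<beta> by (intro add_mono mult_right_mono expD I1) auto
      finally show ?thesis .
    qed
    have b2: "norm (f x) \<le> D * norm (f \<alpha>) + C" if x: "x \<in> {\<alpha>..\<beta>}" for x
    proof -
      have "norm (f x) \<le> norm (exp (\<kappa> * of_real (x - \<alpha>)) * f \<alpha>) + norm (f x - exp (\<kappa> * of_real (x - \<alpha>)) * f \<alpha>)"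
        using norm_triangle_ineq[of "exp (\<kappa> * of_real (x - \<alpha>)) * f \<alpha>" "f x - exp (\<kappa> * of_real (x - \<alpha>)) * f \<alpha>"] by simp
      also have "\<dots> \<le> D * norm (f \<alpha>) + C"
        unfolding norm_mult using x \<alpha> \<alpha>\<beta> by (intro add_mono mult_right_mono expD I2) auto
      finally show ?thesis .
    qed
    have "norm (f \<alpha>) \<le> D * norm (f 0) + C"
      using b1[of 1] by (simp add: bc(2) norm_mult)
    then have "D * norm (f \<alpha>) + C \<le> D * (D * norm (f 0) + C) + C"
      using \<open>D \<ge> 1\<close> by (intro add_mono mult_left_mono) auto
    moreover have "D * norm (f 0) + C \<le> D * (D * norm (f 0) + C) + C"
    proof -
      have "1 * (D * norm (f 0) + C) \<le> D * (D * norm (f 0) + C)"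
        using \<open>D \<ge> 1\<close> \<open>C \<ge> 0\<close> by (intro mult_right_mono) auto
      then show ?thesis using \<open>C \<ge> 0\<close> by simp
    qed
    moreover have "D * (D * norm (f 0) + C) + C \<le> K * A"
    proof -
      have "D * (D * norm (f 0) + C) + C = D\<^sup>2 * norm (f 0) + (D + 1) * C"
        by (simp add: algebra_simps power2_eq_square)
      also have "\<dots> \<le> D\<^sup>2 * ((1 + D) * C / E) + (D + 1) * C"
        using f0 by (intro add_right_mono mult_left_mono) auto
      also have "\<dots> = K * A"
        using \<open>E > 0\<close> by (simp add: K_def C_def field_simps)
      finally show ?thesis .
    qed
    ultimately have bound: "norm (f x) \<le> K * A" if "x \<in> S" for x
      using b1[of x] b2[of x] that by (auto simp: two_intervals_def)
    have "L2_norm M f \<le> K * A * sqrt len"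
      using L2_space_bounded(2)[OF finite_measure_M, of f "K * A"] P\<^sub>B_minus_z_in_L2(1)[OF dom] bound
      by (simp add: L2_space_def measure_M)
    also have "\<dots> \<le> K * (sqrt len * L2_norm M (\<lambda>x. snd P\<^sub>B f x - z * f x)) * sqrt len"
      using L2_imp_integrable(2)[OF finite_measure_M P\<^sub>B_minus_z_in_L2(2)[OF dom, of z]] \<open>D \<ge> 1\<close> \<open>E > 0\<close> len_pos
      by (intro mult_right_mono mult_left_mono) (auto simp: A_def measure_M K_def)
    also have "\<dots> = (K * len) * L2_norm M (\<lambda>x. snd P\<^sub>B f x - z * f x)"
    proof -
      have "K * (sqrt len * X) * sqrt len = K * (sqrt len * sqrt len) * X" for X
        by (simp only: mult_ac)
      then show ?thesis using real_sqrt_mult_self[of len] len_pos by (simp only: abs_of_pos)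
    qed
    finally show ?thesis .
  qed
  then show ?thesis by blast
qed

text \<open>Solve the equation on each interval by variation of constants. The boundary conditions are then
  two linear equations for the initial values \<open>c\<close> and \<open>d\<close>; eliminating \<open>d\<close> leaves one equation for \<open>c\<close> with the
  coefficient \<open>1 + e(\<theta>) exp (\<kappa> (1 + \<beta> - \<alpha>))\<close>.\<close>
lemma resolvent_surjective:
  fixes z :: complex
  defines "\<kappa> \<equiv> 2 * pi * \<i> * z"
  assumes nz: "1 + e_fun \<theta> * exp (\<kappa> * of_real len) \<noteq> 0" and h: "h \<in> L2_space M"
  shows "\<exists>f\<in>fst P\<^sub>B. AE x in M. snd P\<^sub>B f x - z * f x = h x"
proof -
  define r where "r x = 2 * pi * \<i> * h x" for x
  have rL: "r \<in> L2_space M" unfolding r_def by (rule L2_space_scale[OF h])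
  have sub: "{0..1} \<subseteq> S" "{\<alpha>..\<beta>} \<subseteq> S" by (auto simp: two_intervals_def)
  have r: "r absolutely_integrable_on {0..1}" "r absolutely_integrable_on {\<alpha>..\<beta>}"
    using L2_on_subinterval(1)[OF rL] sub by auto
  define H1 where "H1 = integral {0..1} (\<lambda>t. exp (- \<kappa> * of_real t) * r t)"
  define H2 where "H2 = integral {\<alpha>..\<beta>} (\<lambda>t. exp (- \<kappa> * of_real t) * r t)"
  \<comment> \<open>one turn around the circle carries the initial value \<open>c\<close> to \<open>- W c\<close>\<close>
  define W where "W = e_fun \<theta> * exp (\<kappa> * of_real len)"
  define c where "c = - (W * H1 + e_fun (\<theta> - \<psi>) * exp (\<kappa> * of_real \<beta>) * H2) / (1 + W)"
  define d where "d = exp (- \<kappa> * of_real \<alpha>) * e_fun \<psi> * exp \<kappa> * (c + H1)"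
  define f1 where "f1 x = exp (\<kappa> * of_real x) * (c + integral {0..x} (\<lambda>t. exp (- \<kappa> * of_real t) * r t))" for x
  define f2 where "f2 x = exp (\<kappa> * of_real x) * (d + integral {\<alpha>..x} (\<lambda>t. exp (- \<kappa> * of_real t) * r t))" for x
  define f where "f x = (if x \<le> 1 then f1 x else f2 x)" for x
  have ac1: "absolutely_continuous_fun_on f1 {0..1}"
    and ac2: "absolutely_continuous_fun_on f2 {\<alpha>..\<beta>}"
    unfolding f1_def f2_def using variation_of_constants_solution(1) r by auto
  have ac: "absolutely_continuous_fun_on f {0..1}" "absolutely_continuous_fun_on f {\<alpha>..\<beta>}"
    using \<alpha> by (auto intro!: absolutely_continuous_cong[OF ac1] absolutely_continuous_cong[OF ac2] simp: f_def)
  obtain N1 where N1: "negligible N1"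
    "\<And>x. x \<in> {0<..<1} - N1 \<Longrightarrow> (f1 has_vector_derivative \<kappa> * f1 x + r x) (at x)"
    using variation_of_constants_solution(2)[OF r(1), of \<kappa> c, folded f1_def] by blast
  obtain N2 where N2: "negligible N2"
    "\<And>x. x \<in> {\<alpha><..<\<beta>} - N2 \<Longrightarrow> (f2 has_vector_derivative \<kappa> * f2 x + r x) (at x)"
    using variation_of_constants_solution(2)[OF r(2), of \<kappa> d, folded f2_def] by blast
  have N: "negligible (N1 \<union> N2 \<union> {0, 1, \<alpha>, \<beta>})" using N1(1) N2(1) by simp
  have deriv: "(f has_vector_derivative \<kappa> * f x + r x) (at x)"
    if x: "x \<in> S - (N1 \<union> N2 \<union> {0, 1, \<alpha>, \<beta>})" for x
  proof -
    consider "x \<in> {0<..<1}" | "x \<in> {\<alpha><..<\<beta>}" using x by (auto simp: two_intervals_def)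
    then show ?thesis
    proof cases
      case 1
      with x have "(f1 has_vector_derivative \<kappa> * f1 x + r x) (at x)" by (intro N1(2)) auto
      then have "(f has_vector_derivative \<kappa> * f1 x + r x) (at x)"
        by (rule has_vector_derivative_transform_within_open[OF _ open_greaterThanLessThan 1])
          (auto simp: f_def)
      then show ?thesis using 1 by (simp add: f_def)
    next
      case 2
      with x have "(f2 has_vector_derivative \<kappa> * f2 x + r x) (at x)" by (intro N2(2)) auto
      then have "(f has_vector_derivative \<kappa> * f2 x + r x) (at x)"
        by (rule has_vector_derivative_transform_within_open[OF _ open_greaterThanLessThan 2])
          (use \<alpha> in \<open>auto simp: f_def\<close>)
      then show ?thesis using 2 \<alpha> by (simp add: f_def)
    qed
  qed
  have L2: "(\<lambda>x. \<kappa> * f x + r x) \<in> L2_space M"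
    by (rule L2_space_add[OF L2_space_scale[OF L2_piecewise_bounded[OF
          ac[THEN absolutely_continuous_imp_continuous_on]]] rL])
  have dom: "f \<in> max_momentum_dom \<alpha> \<beta>" "AE x in M. interval_deriv \<alpha> \<beta> f x = \<kappa> * f x + r x"
    using max_momentum_domI[OF ac N deriv L2] by simp_all
  have v: "f 0 = c" "f 1 = exp \<kappa> * (c + H1)" "f \<alpha> = exp (\<kappa> * of_real \<alpha>) * d"
    "f \<beta> = exp (\<kappa> * of_real \<beta>) * (d + H2)"
    using \<alpha> \<alpha>\<beta> by (auto simp: f_def f1_def f2_def H1_def H2_def)
  have "f \<alpha> = e_fun \<psi> * f 1"
    unfolding v d_def by (simp add: exp_minus)
  moreover have "f 0 = - e_fun (\<theta> - \<psi>) * f \<beta>"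
  proof -
    have e: "e_fun \<theta> = e_fun (\<theta> - \<psi>) * e_fun \<psi>" by (simp flip: e_fun_add)
    have x: "exp (\<kappa> * of_real \<beta>) * exp (- \<kappa> * of_real \<alpha>) * exp \<kappa> = exp (\<kappa> * of_real len)"
      by (simp add: algebra_simps flip: exp_add)
    have "e_fun (\<theta> - \<psi>) * f \<beta> = e_fun (\<theta> - \<psi>) * e_fun \<psi>
        * (exp (\<kappa> * of_real \<beta>) * exp (- \<kappa> * of_real \<alpha>) * exp \<kappa>) * (c + H1)
        + e_fun (\<theta> - \<psi>) * exp (\<kappa> * of_real \<beta>) * H2"
      unfolding v d_def by (simp add: algebra_simps)
    also have "\<dots> = W * (c + H1) + e_fun (\<theta> - \<psi>) * exp (\<kappa> * of_real \<beta>) * H2"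
      by (simp only: x W_def flip: e)
    also have "\<dots> = - c"
    proof -
      have "1 + W \<noteq> 0" using nz by (simp add: W_def)
      then have "c * (1 + W) = - (W * H1 + e_fun (\<theta> - \<psi>) * exp (\<kappa> * of_real \<beta>) * H2)"
        by (simp add: c_def)
      moreover have "W * (c + H1) + X = c * (1 + W) + (W * H1 + X) - c" for X
        by (simp add: algebra_simps)
      ultimately show ?thesis by simp
    qed
    finally show ?thesis by (simp add: v)
  qed
  ultimately have "f \<in> fst P\<^sub>B" using dom(1) by (simp add: P\<^sub>B_domain_iff)
  moreover have "AE x in M. snd P\<^sub>B f x - z * f x = h x"
    using dom(2)
  proof eventually_elim
    case (elim x)
    then show ?case by (simp add: P\<^sub>B_apply \<kappa>_def r_def field_simps)
  qed
  ultimately show ?thesis by blast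
qed

lemma resolvent_setI:
  fixes z :: complex
  assumes "1 + e_fun \<theta> * exp (2 * pi * \<i> * z * of_real len) \<noteq> 0"
  shows "z \<in> resolvent_set M P\<^sub>B"
  using resolvent_lower_bound[OF assms] resolvent_surjective[OF assms]
  by (simp add: resolvent_set_def)

section \<open>Eigenfunctions\<close>

definition eigenvalue :: "int \<Rightarrow> real" where
  "eigenvalue n = (1/2 - \<theta> + of_int n) / len"

text \<open>The phase of the \<open>n\<close>-th eigenfunction on the first interval relative to the second.\<close>
definition phase :: "int \<Rightarrow> real" where
  "phase n = 1/2 - \<psi> + ((1/2 + of_int n) * \<beta> + (1 - \<alpha>) * \<theta>) / len"

definition eigenfunction :: "int \<Rightarrow> real \<Rightarrow> complex" where
  "eigenfunction n = (\<lambda>x. (e_fun (phase n)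
      * indicator {0..1} x + indicator {\<alpha>..\<beta>} x) * e_fun (eigenvalue n * x))"

lemma eigenfunction_left:
  assumes "x \<in> {0..1}"
  shows "eigenfunction n x = e_fun (phase n + eigenvalue n * x)"
proof -
  have "x \<notin> {\<alpha>..\<beta>}" using assms \<alpha> by auto
  then show ?thesis using assms unfolding e_fun_add eigenfunction_def by simp
qed

lemma eigenfunction_right:
  assumes "x \<in> {\<alpha>..\<beta>}"
  shows "eigenfunction n x = e_fun (eigenvalue n * x)"
proof -
  have "x \<notin> {0..1}" using assms \<alpha> by auto
  then show ?thesis using assms unfolding eigenfunction_def by simp
qed

lemma norm_eigenfunction: "x \<in> S \<Longrightarrow> norm (eigenfunction n x) = 1"
  unfolding two_intervals_def using eigenfunction_left[of x n] eigenfunction_right[of x n] by auto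

text \<open>The two boundary conditions each prescribe the phase modulo one; for the eigenvalues they agree. The first
  equation serves the condition at \<open>0\<close> and \<open>\<beta>\<close>, the second one the condition at \<open>1\<close> and \<open>\<alpha>\<close>.\<close>
lemma phase_eq:
  "phase n = eigenvalue n * \<beta> + \<theta> - \<psi> + 1/2"
  "phase n = eigenvalue n * (\<alpha> - 1) - \<psi> + of_int (n + 1)"
proof -
  have "((1/2 + of_int n) * \<beta> + (1 - \<alpha>) * \<theta>) = (1/2 - \<theta> + of_int n) * \<beta> + \<theta> * len"
    by (simp add: algebra_simps)
  then have "((1/2 + of_int n) * \<beta> + (1 - \<alpha>) * \<theta>) / len = eigenvalue n * \<beta> + \<theta>"
    using len_pos by (simp add: add_divide_distrib[of _ "\<theta> * len"] eigenvalue_def)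
  then show 1: "phase n = eigenvalue n * \<beta> + \<theta> - \<psi> + 1/2"
    by (simp add: phase_def)
  have "eigenvalue n * len = 1/2 - \<theta> + of_int n"
    using len_pos by (simp add: eigenvalue_def)
  then show "phase n = eigenvalue n * (\<alpha> - 1) - \<psi> + of_int (n + 1)"
    unfolding 1 by (simp add: algebra_simps)
qed

lemma e_fun_affine_exp:
  "e_fun (c + t * x) = e_fun c * exp (2 * pi * \<i> * of_real t * of_real x)"
  unfolding e_fun_add by (simp add: e_fun_def mult_ac)

lemma e_fun_affine_vector_derivative:
  "((\<lambda>x. e_fun (c + t * x)) has_vector_derivative 2 * pi * \<i> * of_real t * e_fun (c + t * x)) (at x)"
proof -
  have "((\<lambda>w. e_fun c * exp (2 * pi * \<i> * of_real t * w)) has_field_derivative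
      2 * pi * \<i> * of_real t * (e_fun c * exp (2 * pi * \<i> * of_real t * of_real x))) (at (of_real x))"
    by (auto intro!: derivative_eq_intros)
  then show ?thesis
    unfolding e_fun_affine_exp by (rule has_vector_derivative_real_field)
qed

lemma e_fun_affine_absolutely_continuous:
  "absolutely_continuous_fun_on (\<lambda>x. e_fun (c + t * x)) {a..b}"
  unfolding e_fun_affine_exp
  by (rule absolutely_continuous_mult[OF _ absolutely_continuous_exp])
    (rule lipschitz_imp_absolutely_continuous[of _ _ _ 0], simp)

lemma eigenfunction_absolutely_continuous:
  "absolutely_continuous_fun_on (eigenfunction n) {0..1}"
  "absolutely_continuous_fun_on (eigenfunction n) {\<alpha>..\<beta>}"
proof -
  show "absolutely_continuous_fun_on (eigenfunction n) {0..1}"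
    by (rule absolutely_continuous_cong[OF e_fun_affine_absolutely_continuous[of "phase n" "eigenvalue n"]])
      (simp add: eigenfunction_left)
  show "absolutely_continuous_fun_on (eigenfunction n) {\<alpha>..\<beta>}"
    by (rule absolutely_continuous_cong[OF e_fun_affine_absolutely_continuous[of 0 "eigenvalue n"]])
      (simp add: eigenfunction_right)
qed

lemma eigenfunction_in_eigenspace:
  "eigenfunction n \<in> eigenspace M P\<^sub>B (of_real (eigenvalue n))"
proof -
  let ?f = "eigenfunction n" and ?l = "eigenvalue n"
  let ?d = "\<lambda>x. 2 * pi * \<i> * of_real ?l * ?f x"
  have d: "(?f has_vector_derivative ?d x) (at x)" if x: "x \<in> S - {0, 1, \<alpha>, \<beta>}" for x
  proof -
    consider "x \<in> {0<..<1}" | "x \<in> {\<alpha><..<\<beta>}" using x by (auto simp: two_intervals_def)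
    then show ?thesis
    proof cases
      case 1
      have "(?f has_vector_derivative 2 * pi * \<i> * of_real ?l * e_fun (phase n + ?l * x)) (at x)"
        by (rule has_vector_derivative_transform_within_open
            [OF e_fun_affine_vector_derivative open_greaterThanLessThan 1])
          (simp add: eigenfunction_left)
      then show ?thesis using 1 by (simp add: eigenfunction_left)
    next
      case 2
      have "(?f has_vector_derivative 2 * pi * \<i> * of_real ?l * e_fun (0 + ?l * x)) (at x)"
        by (rule has_vector_derivative_transform_within_open
            [OF e_fun_affine_vector_derivative open_greaterThanLessThan 2])
          (simp add: eigenfunction_right)
      then show ?thesis using 2 by (simp add: eigenfunction_right)
    qed
  qed
  have L2: "?d \<in> L2_space M"
    by (rule L2_space_scale[OF L2_piecewise_bounded[OF
          eigenfunction_absolutely_continuous[THEN absolutely_continuous_imp_continuous_on]]])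
  have N: "negligible {0, 1, \<alpha>, \<beta>}" by simp
  have dom: "?f \<in> max_momentum_dom \<alpha> \<beta>" "AE x in M. interval_deriv \<alpha> \<beta> ?f x = ?d x"
    using max_momentum_domI[OF eigenfunction_absolutely_continuous N d L2] by simp_all
  have "?f 0 = - e_fun (\<theta> - \<psi>) * ?f \<beta>"
  proof -
    have "e_fun (phase n) = e_fun (?l * \<beta>) * e_fun (\<theta> - \<psi>) * e_fun (1/2)"
      by (simp only: phase_eq(1) add_diff_eq flip: e_fun_add)
    then show ?thesis
      using \<alpha>\<beta> by (simp only: e_fun_half) (simp add: eigenfunction_left eigenfunction_right)
  qed
  moreover have "?f \<alpha> = e_fun \<psi> * ?f 1"
  proof -
    have "e_fun \<psi> * e_fun (phase n + ?l) = e_fun (?l * \<alpha> + of_int (n + 1))"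
      by (simp add: phase_eq(2) algebra_simps flip: e_fun_add)
    also have "\<dots> = e_fun (?l * \<alpha>)"
      by (simp only: e_fun_add e_fun_of_int mult_1_right)
    finally show ?thesis
      using \<alpha>\<beta> by (simp add: eigenfunction_left eigenfunction_right)
  qed
  ultimately have "?f \<in> fst P\<^sub>B" using dom(1) by (simp add: P\<^sub>B_domain_iff)
  moreover have "AE x in M. snd P\<^sub>B ?f x = of_real ?l * ?f x"
    using dom(2) by eventually_elim (simp add: P\<^sub>B_apply)
  ultimately show ?thesis by (simp add: eigenspace_def)
qed

lemma AE_M_not_all_nonzero:
  assumes "AE x in M. g x = 0" "\<And>x. x \<in> S \<Longrightarrow> g x \<noteq> (0::complex)"
  shows False
proof -
  obtain N where "negligible N" "\<forall>x\<in>S - N. g x = 0"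
    using assms(1) unfolding AE_lebesgue_on_iff_negligible[OF S_sets] by blast
  then have "negligible S" using assms(2) by (meson DiffI negligible_subset subsetI)
  then have "measure M S = 0" by (simp add: measure_restrict_space negligible_imp_measure0)
  then show False using measure_M len_pos by simp
qed

lemma eigenfunction_is_eigenfunction:
  "is_eigenfunction M P\<^sub>B (of_real (eigenvalue n)) (eigenfunction n)"
proof -
  have "eigenfunction n x \<noteq> 0" if "x \<in> S" for x
    using norm_eigenfunction[OF that, of n] by auto
  then show ?thesis
    unfolding is_eigenfunction_def
    using eigenfunction_in_eigenspace AE_M_not_all_nonzero[of "eigenfunction n"] by blast
qed

lemma eigenspace_propagation:
  assumes "f \<in> eigenspace M P\<^sub>B z"
  shows "x \<in> {0..1} \<Longrightarrow> f x = exp (2 * pi * \<i> * z * of_real x) * f 0"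
    and "x \<in> {\<alpha>..\<beta>} \<Longrightarrow> f x = exp (2 * pi * \<i> * z * of_real (x - \<alpha>)) * (e_fun \<psi> * (exp (2 * pi * \<i> * z) * f 0))"
proof -
  have dom: "f \<in> max_momentum_dom \<alpha> \<beta>" and bc: "f \<alpha> = e_fun \<psi> * f 1"
    and ae: "AE x in M. snd P\<^sub>B f x = z * f x"
    using assms by (auto simp: eigenspace_def P\<^sub>B_domain_iff)
  have "AE x in M. norm (snd P\<^sub>B f x - z * f x) = 0"
    using ae by eventually_elim simp
  then have zero: "(\<integral>x. norm (snd P\<^sub>B f x - z * f x) \<partial>M) = 0"
    by (rule integral_eq_zero_AE)
  note bound = domain_propagation_bound[OF dom, of _ z, unfolded zero]
  show left: "f x = exp (2 * pi * \<i> * z * of_real x) * f 0" if "x \<in> {0..1}" for x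
    using bound(1)[OF that] by simp
  show "f x = exp (2 * pi * \<i> * z * of_real (x - \<alpha>)) * (e_fun \<psi> * (exp (2 * pi * \<i> * z) * f 0))"
    if "x \<in> {\<alpha>..\<beta>}" for x
    using bound(2)[OF that] left[of 1] by (simp add: bc)
qed

lemma eigenspace_one_dimensional:
  "has_eigenvalue_multiplicity M P\<^sub>B (of_real (eigenvalue n)) 1"
proof -
  let ?e = "eigenfunction n" and ?z = "complex_of_real (eigenvalue n)"
  have spanned: "\<forall>f\<in>eigenspace M P\<^sub>B ?z. \<exists>c. AE x in M. f x = c * ?e x"
  proof
    fix f assume f: "f \<in> eigenspace M P\<^sub>B ?z"
    have e0: "?e 0 \<noteq> 0" using norm_eigenfunction[of 0 n] by (auto simp: two_intervals_def)
    have "f x = (f 0 / ?e 0) * ?e x" if x: "x \<in> S" for x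
    proof -
      consider "x \<in> {0..1}" | "x \<in> {\<alpha>..\<beta>}" using x by (auto simp: two_intervals_def)
      then show ?thesis
      proof cases
        case 1
        show ?thesis
          unfolding eigenspace_propagation(1)[OF f 1]
            eigenspace_propagation(1)[OF eigenfunction_in_eigenspace[of n] 1]
          using e0 by simp
      next
        case 2
        show ?thesis
          unfolding eigenspace_propagation(2)[OF f 2]
            eigenspace_propagation(2)[OF eigenfunction_in_eigenspace[of n] 2]
          using e0 by simp
      qed
    qed
    then show "\<exists>c. AE x in M. f x = c * ?e x"
      by (intro exI[of _ "f 0 / ?e 0"] AE_I2) simp
  qed
  have one: "c = 0" if "AE x in M. c * ?e x = 0" for c
  proof (rule ccontr)
    assume "c \<noteq> 0"
    then have "c * ?e x \<noteq> 0" if "x \<in> S" for x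
      using norm_eigenfunction[OF that, of n] by auto
    then show False using AE_M_not_all_nonzero[OF that] by blast
  qed
  show ?thesis
    unfolding has_eigenvalue_multiplicity_def
  proof (intro exI[of _ "\<lambda>_. ?e"] conjI allI impI ballI)
    show "?e \<in> eigenspace M P\<^sub>B ?z" by (rule eigenfunction_in_eigenspace)
    show "c i = 0" if "AE x in M. (\<Sum>i<1. c i * ?e x) = 0" "i < 1" for c :: "nat \<Rightarrow> complex" and i
      using one[of "c 0"] that by simp
    fix f assume "f \<in> eigenspace M P\<^sub>B ?z"
    then obtain c where "AE x in M. f x = c * ?e x" using spanned by blast
    then show "\<exists>c :: nat \<Rightarrow> complex. AE x in M. f x = (\<Sum>i<1. c i * ?e x)"
      by (intro exI[of _ "\<lambda>_. c"]) simp
  qed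
qed

lemma eigenvalue_in_spectrum:
  assumes "is_eigenfunction M P\<^sub>B z f"
  shows "z \<in> operator_spectrum M P\<^sub>B"
proof (rule ccontr)
  assume "z \<notin> operator_spectrum M P\<^sub>B"
  then obtain C where C: "\<And>f. f \<in> fst P\<^sub>B \<Longrightarrow> L2_norm M f \<le> C * L2_norm M (\<lambda>x. snd P\<^sub>B f x - z * f x)"
    by (auto simp: operator_spectrum_def resolvent_set_def)
  have f: "f \<in> fst P\<^sub>B" "AE x in M. snd P\<^sub>B f x = z * f x" "\<not> (AE x in M. f x = 0)"
    using assms by (auto simp: is_eigenfunction_def eigenspace_def)
  then have fL: "f \<in> L2_space M" using P\<^sub>B_minus_z_in_L2(1) by (simp add: P\<^sub>B_domain_iff)
  have "AE x in M. (norm (snd P\<^sub>B f x - z * f x))\<^sup>2 = 0"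
    using f(2) by eventually_elim simp
  then have "(\<integral>x. (norm (snd P\<^sub>B f x - z * f x))\<^sup>2 \<partial>M) = 0"
    by (rule integral_eq_zero_AE)
  then have "L2_norm M f \<le> 0" using C[OF f(1)] by (simp add: L2_norm_def)
  then have "(\<integral>x. (norm (f x))\<^sup>2 \<partial>M) = 0"
    by (simp add: L2_norm_def order_antisym)
  then have "AE x in M. (norm (f x))\<^sup>2 = 0"
    using fL by (subst (asm) integral_nonneg_eq_0_iff_AE) (auto simp: L2_space_def)
  then have "AE x in M. f x = 0" by eventually_elim simp
  with f(3) show False by simp
qed

lemma spectrum_subset:
  assumes "z \<in> operator_spectrum M P\<^sub>B"
  shows "\<exists>n. z = of_real (eigenvalue n)"
proof -
  have "1 + e_fun \<theta> * exp (2 * pi * \<i> * z * of_real len) = 0"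
    using resolvent_setI[of z] assms by (auto simp: operator_spectrum_def)
  then have W: "e_fun \<theta> * exp (2 * pi * \<i> * z * of_real len) = -1"
    by (rule minus_unique[symmetric])
  define u where "u = of_real \<theta> + z * of_real len - 1/2"
  have "exp (2 * pi * \<i> * u) = e_fun \<theta> * exp (2 * pi * \<i> * z * of_real len) * exp (- (\<i> * pi))"
    unfolding e_fun_def by (simp add: u_def algebra_simps flip: exp_add)
  also have "\<dots> = 1"
    unfolding W by (simp add: exp_minus)
  finally obtain n :: int where "Im u = 0" "Re u = of_int n"
    by (auto simp: exp_eq_1)
  then have "u = of_int n" by (simp add: complex_eq_iff)
  then have "z * of_real len = of_real (1/2 - \<theta> + of_int n)"
    by (simp add: u_def algebra_simps)
  then have "z = of_real (eigenvalue n)"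
    using len_pos unfolding eigenvalue_def of_real_divide
    by (intro nonzero_eq_divide_eq[THEN iffD2]) (auto simp del: of_real_diff of_real_add)
  then show ?thesis ..
qed

section \<open>Totality of the eigenfunctions\<close>

text \<open>The gluing map: the coordinate of the circle runs through \<open>[0,1]\<close> and then, without a gap, through
  \<open>[\<alpha>,\<beta>]\<close>, and is rescaled to total length one.\<close>
definition circle_map :: "real \<Rightarrow> complex" where
  "circle_map x = (if x \<le> 1 then e_fun (x / len) else e_fun ((x - \<alpha> + 1) / len))"

lemma e_fun_continuous: "continuous_on A f \<Longrightarrow> continuous_on A (\<lambda>x. e_fun (f x))"
  unfolding e_fun_def by (intro continuous_intros)

lemma circle_map_continuous: "continuous_on S circle_map"
proof -
  have "continuous_on {0..1} circle_map"
    by (rule continuous_on_eq[of _ "\<lambda>x. e_fun (x / len)"])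
      (use len_pos in \<open>auto intro!: e_fun_continuous continuous_intros simp: circle_map_def\<close>)
  moreover have "continuous_on {\<alpha>..\<beta>} circle_map"
    by (rule continuous_on_eq[of _ "\<lambda>x. e_fun ((x - \<alpha> + 1) / len)"])
      (use len_pos \<alpha> in \<open>auto intro!: e_fun_continuous continuous_intros simp: circle_map_def\<close>)
  ultimately show ?thesis
    unfolding two_intervals_def by (intro continuous_on_closed_Un) auto
qed

lemma circle_map_in_circle: "circle_map ` A \<subseteq> sphere 0 1"
  by (auto simp: circle_map_def)

lemma e_fun_powi: "e_fun x powi n = e_fun (of_int n * x)"
  by (simp add: e_fun_eq_cis cis_power_int mult_ac)

lemma e_fun_eq_imp:
  assumes "e_fun s = e_fun t" "\<bar>s - t\<bar> < 1"
  shows "s = t"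
proof -
  have "e_fun (s - t) * e_fun t = e_fun t" using assms(1) by (simp flip: e_fun_add)
  then have "e_fun (s - t) = 1" using norm_e_fun[of t] by (auto simp del: norm_e_fun)
  then obtain n :: int where "s - t = of_int n"
    by (auto simp: e_fun_def exp_eq_1)
  with assms(2) have "\<bar>n\<bar> < 1" by linarith
  with \<open>s - t = of_int n\<close> show ?thesis by simp
qed

text \<open>Only endpoints are identified, \<open>1\<close> with \<open>\<alpha>\<close> and \<open>0\<close> with \<open>\<beta>\<close>. So every function that vanishes at the endpoints is
  constant on the fibres of the gluing map.\<close>
lemma circle_map_eq_imp:
  assumes x: "x \<in> S" and y: "y \<in> S" and eq: "circle_map x = circle_map y"
  shows "x = y \<or> {x, y} \<subseteq> {0, 1, \<alpha>, \<beta>}"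
proof -
  \<comment> \<open>the coordinate on the circle before rescaling\<close>
  define \<tau> where "\<tau> x = (if x \<le> 1 then x else x - \<alpha> + 1)" for x
  have range: "0 \<le> \<tau> x" "\<tau> x \<le> len" if "x \<in> S" for x
    using that \<alpha> \<alpha>\<beta> by (auto simp: \<tau>_def two_intervals_def)
  have ends: "x \<in> {0, 1, \<alpha>, \<beta>}" if "x \<in> S" "\<tau> x = 0 \<or> \<tau> x = 1 \<or> \<tau> x = len" for x
    using that \<alpha> \<alpha>\<beta> by (auto simp: \<tau>_def two_intervals_def split: if_splits)
  have e: "e_fun (\<tau> x / len) = e_fun (\<tau> y / len)"
    using eq by (auto simp: circle_map_def \<tau>_def split: if_splits)
  show ?thesis
  proof (cases "\<bar>\<tau> x / len - \<tau> y / len\<bar> < 1")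
    case True
    then have t: "\<tau> x = \<tau> y" using e_fun_eq_imp[OF e] len_pos by simp
    show ?thesis
    proof (cases "x \<le> 1 \<longleftrightarrow> y \<le> 1")
      case True
      then show ?thesis using t by (auto simp: \<tau>_def split: if_splits)
    next
      case False
      then have "\<tau> x = 1" using t x y \<alpha> \<alpha>\<beta> by (auto simp: \<tau>_def two_intervals_def split: if_splits)
      then show ?thesis using ends[OF x] ends[OF y] t by simp
    qed
  next
    case False
    then have "1 * len \<le> \<bar>\<tau> x - \<tau> y\<bar>"
      using len_pos by (simp add: not_less pos_le_divide_eq flip: diff_divide_distrib)
    then have "(\<tau> x = 0 \<or> \<tau> x = len) \<and> (\<tau> y = 0 \<or> \<tau> y = len)"
      using range[OF x] range[OF y] by (smt (verit))
    then have "x \<in> {0, 1, \<alpha>, \<beta>}" "y \<in> {0, 1, \<alpha>, \<beta>}"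
      by (intro ends x y; blast)+
    then show ?thesis by simp
  qed
qed

text \<open>Neighbouring eigenvalues differ by \<open>1 / (1 + \<beta> - \<alpha>)\<close>, so passing to the next eigenfunction
  multiplies by \<open>e(x / (1 + \<beta> - \<alpha>))\<close>. On the second interval this is the gluing map shifted by
  \<open>\<alpha> - 1\<close>, which produces the constant factor; on the first interval the phase supplies the same factor.\<close>
lemma eigenfunction_circle_map:
  assumes x: "x \<in> S"
  shows "eigenfunction n x = e_fun (of_int n * (\<alpha> - 1) / len) * (eigenfunction 0 x * circle_map x powi n)"
proof -
  have ev: "eigenvalue n = eigenvalue 0 + of_int n / len"
    by (simp add: eigenvalue_def add_divide_distrib)
  consider "x \<in> {0..1}" | "x \<in> {\<alpha>..\<beta>}" using x by (auto simp: two_intervals_def)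
  then show ?thesis
  proof cases
    case 1
    have "phase n + eigenvalue n * x
        = of_int n * (\<alpha> - 1) / len + (phase 0 + eigenvalue 0 * x) + of_int n * (x / len) + of_int n"
      unfolding ev phase_eq(2) by (simp add: algebra_simps diff_divide_distrib)
    then have "e_fun (phase n + eigenvalue n * x) = e_fun (of_int n * (\<alpha> - 1) / len)
        * (e_fun (phase 0 + eigenvalue 0 * x) * e_fun (of_int n * (x / len)))"
      by (simp only: e_fun_add e_fun_of_int mult_1_right mult.assoc)
    then show ?thesis
      using 1 by (simp add: eigenfunction_left circle_map_def e_fun_powi)
  next
    case 2
    have "eigenvalue n * x = of_int n * (\<alpha> - 1) / len + eigenvalue 0 * x + of_int n * ((x - \<alpha> + 1) / len)"
      unfolding ev by (simp add: algebra_simps diff_divide_distrib add_divide_distrib)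
    then have "e_fun (eigenvalue n * x) = e_fun (of_int n * (\<alpha> - 1) / len)
        * (e_fun (eigenvalue 0 * x) * e_fun (of_int n * ((x - \<alpha> + 1) / len)))"
      by (simp only: e_fun_add mult.assoc)
    then show ?thesis
      using 2 \<alpha> by (simp add: eigenfunction_right circle_map_def e_fun_powi)
  qed
qed

lemma Laurent_polynomial_circle_map_in_span:
  assumes "q \<in> Laurent_polynomials"
  shows "\<exists>k\<in>fun_span (range eigenfunction). \<forall>x\<in>S. k x = eigenfunction 0 x * q (circle_map x)"
  using assms
proof (induction rule: Laurent_polynomials_induct)
  case zero
  show ?case using fun_span.zero by (intro bexI) auto
next
  case (step c n q)
  then obtain k where k: "k \<in> fun_span (range eigenfunction)"
    "\<forall>x\<in>S. k x = eigenfunction 0 x * q (circle_map x)" by blast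
  let ?w = "e_fun (of_int n * (\<alpha> - 1) / len)"
  have "?w \<noteq> 0" using norm_e_fun by (metis norm_zero zero_neq_one)
  have span: "(\<lambda>x. c / ?w * eigenfunction n x + k x) \<in> fun_span (range eigenfunction)"
    by (rule fun_span.step[OF rangeI k(1)])
  have "c / ?w * eigenfunction n x + k x = eigenfunction 0 x * (c * circle_map x powi n + q (circle_map x))"
    if "x \<in> S" for x
    using \<open>?w \<noteq> 0\<close> k(2) that by (simp add: eigenfunction_circle_map[OF that, of n] ring_distribs)
  then show ?case by (intro bexI[OF _ span] ballI)
qed

lemma eigenfunction_measurable: "eigenfunction n \<in> borel_measurable M"
  using L2_piecewise_bounded[OF eigenfunction_absolutely_continuous[THEN absolutely_continuous_imp_continuous_on]]
  by (simp add: L2_space_def)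

text \<open>Dividing by the \<open>0\<close>-th eigenfunction, which has modulus one on the two intervals, is an isometry of \<open>L\<^sup>2\<close>
  that turns the eigenfunctions into multiples of powers of the gluing map.\<close>
lemma eigenfunctions_total_P\<^sub>B: "eigenfunctions_total M P\<^sub>B"
  unfolding eigenfunctions_total_def
proof (intro ballI allI impI)
  fix h and \<epsilon> :: real assume h: "h \<in> L2_space M" and "\<epsilon> > 0"
  define u where "u x = h x / eigenfunction 0 x" for x
  have u: "u \<in> L2_space M"
  proof -
    have "u \<in> borel_measurable M"
      unfolding u_def using h eigenfunction_measurable[of 0]
      by (intro borel_measurable_divide) (auto simp: L2_space_def)
    moreover have "integrable M (\<lambda>x. (norm (u x))\<^sup>2) \<longleftrightarrow> integrable M (\<lambda>x. (norm (h x))\<^sup>2)"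
      by (intro Bochner_Integration.integrable_cong) (auto simp: u_def norm_divide norm_eigenfunction)
    ultimately show ?thesis using h by (simp add: L2_space_def)
  qed
  let ?Z = "{0, 1, \<alpha>, \<beta>}"
  have "\<epsilon>\<^sup>2 / 4 > 0" using \<open>\<epsilon> > 0\<close> by simp
  obtain G where G: "continuous_on UNIV G" "\<And>x. x \<in> ?Z \<Longrightarrow> G x = 0"
    "(\<lambda>x. u x - G x) \<in> L2_space M" "(\<integral>x. (norm (u x - G x))\<^sup>2 \<partial>M) < \<epsilon>\<^sup>2 / 4"
    by (rule continuous_vanishing_dense_L2[OF S_lmeasurable u _ _ _ \<open>\<epsilon>\<^sup>2 / 4 > 0\<close>, of ?Z])
      (auto intro: finite_imp_closed)
  \<comment> \<open>with this choice, twice the squared uniform error integrates to \<open>\<epsilon>\<^sup>2 / 2\<close>, the same as the bound for the contribution of \<open>G\<close>\<close>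
  define \<delta> where "\<delta> = \<epsilon> / (2 * sqrt len)"
  have "\<delta> > 0" using \<open>\<epsilon> > 0\<close> len_pos by (simp add: \<delta>_def)
  have "compact S" by (auto simp: two_intervals_def intro!: compact_Un)
  have Geq: "G x = G y" if "x \<in> S" "y \<in> S" "circle_map x = circle_map y" for x y
    using circle_map_eq_imp[OF that] G(2)[of x] G(2)[of y] by auto
  obtain q where q: "q \<in> Laurent_polynomials" "\<And>x. x \<in> S \<Longrightarrow> norm (G x - q (circle_map x)) < \<delta>"
    using Laurent_polynomials_dense_pullback[OF \<open>compact S\<close> circle_map_continuous circle_map_in_circle
        continuous_on_subset[OF G(1)] Geq \<open>\<delta> > 0\<close>] by blast
  obtain k where k: "k \<in> fun_span (range eigenfunction)"
    "\<And>x. x \<in> S \<Longrightarrow> k x = eigenfunction 0 x * q (circle_map x)"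
    using Laurent_polynomial_circle_map_in_span[OF q(1)] by blast
  obtain F c where F: "finite F" "F \<subseteq> range eigenfunction" "k = (\<lambda>x. \<Sum>f\<in>F. c f * f x)"
    using fun_span_finite_sum[OF k(1)] by blast
  have km: "k \<in> borel_measurable M"
    unfolding F(3) using F(2) eigenfunction_measurable
    by (intro borel_measurable_sum borel_measurable_times borel_measurable_const) auto
  have hk: "norm (h x - k x) \<le> norm (u x - G x) + \<delta>" if x: "x \<in> S" for x
  proof -
    have "h x = eigenfunction 0 x * u x"
      using norm_eigenfunction[OF x, of 0] by (auto simp: u_def)
    then have "h x - k x = eigenfunction 0 x * ((u x - G x) + (G x - q (circle_map x)))"
      by (simp add: k(2)[OF x] algebra_simps)
    then have "norm (h x - k x) = norm ((u x - G x) + (G x - q (circle_map x)))"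
      by (simp add: norm_mult norm_eigenfunction[OF x])
    also have "\<dots> \<le> norm (u x - G x) + \<delta>"
      using q(2)[OF x] norm_triangle_ineq[of "u x - G x" "G x - q (circle_map x)"] by linarith
    finally show ?thesis .
  qed
  interpret finite_measure M by (rule finite_measure_M)
  have sq: "(norm (h x - k x))\<^sup>2 \<le> 2 * (norm (u x - G x))\<^sup>2 + 2 * \<delta>\<^sup>2" if x: "x \<in> S" for x
  proof -
    have "(norm (h x - k x))\<^sup>2 \<le> (norm (u x - G x) + \<delta>)\<^sup>2"
      using hk[OF x] by (intro power_mono) auto
    also have "\<dots> \<le> 2 * (norm (u x - G x))\<^sup>2 + 2 * \<delta>\<^sup>2"
      using zero_le_power2[of "norm (u x - G x) - \<delta>"] by (simp add: power2_sum power2_diff)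
    finally show ?thesis .
  qed
  have gi: "integrable M (\<lambda>x. 2 * (norm (u x - G x))\<^sup>2 + 2 * \<delta>\<^sup>2)"
    using G(3) by (simp add: L2_space_def)
  have "(\<integral>x. (norm (h x - k x))\<^sup>2 \<partial>M) \<le> (\<integral>x. 2 * (norm (u x - G x))\<^sup>2 + 2 * \<delta>\<^sup>2 \<partial>M)"
  proof (rule integral_mono_AE'[OF gi])
    show "AE x in M. (norm (h x - k x))\<^sup>2 \<le> 2 * (norm (u x - G x))\<^sup>2 + 2 * \<delta>\<^sup>2"
      using sq by (intro AE_I2) simp
  qed auto
  also have "\<dots> = 2 * (\<integral>x. (norm (u x - G x))\<^sup>2 \<partial>M) + 2 * \<delta>\<^sup>2 * len"
    using G(3) by (simp add: L2_space_def measure_M)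
  also have "\<dots> < \<epsilon>\<^sup>2"
  proof -
    have "2 * \<delta>\<^sup>2 * len = \<epsilon>\<^sup>2 / 2"
    proof -
      have "\<delta>\<^sup>2 = \<epsilon>\<^sup>2 / (2\<^sup>2 * (sqrt len)\<^sup>2)"
        by (simp only: \<delta>_def power_divide power_mult_distrib)
      also have "(sqrt len)\<^sup>2 = len" using len_pos by (intro real_sqrt_pow2) simp
      finally have \<delta>2: "\<delta>\<^sup>2 = \<epsilon>\<^sup>2 / (2\<^sup>2 * len)" .
      have "2 * (a / (2\<^sup>2 * l)) * l = a / 2" if "l > 0" for a l :: real
        using that by simp
      from this[OF len_pos] show ?thesis unfolding \<delta>2 .
    qed
    then show ?thesis using G(4) by simp
  qed
  finally have "L2_norm M (\<lambda>x. h x - k x) < \<epsilon>"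
    unfolding L2_norm_def using \<open>\<epsilon> > 0\<close> by (intro real_less_lsqrt) auto
  then show "\<exists>F c. finite F \<and> (\<forall>f\<in>F. \<exists>z. is_eigenfunction M P\<^sub>B z f) \<and>
      L2_norm M (\<lambda>x. h x - (\<Sum>f\<in>F. c f * f x)) < \<epsilon>"
    using F eigenfunction_is_eigenfunction by (intro exI[of _ F] exI[of _ c]) auto
qed

lemma spectrum_eq:
  "operator_spectrum M P\<^sub>B = range (\<lambda>n. of_real (eigenvalue n))"
  "point_spectrum M P\<^sub>B = range (\<lambda>n. of_real (eigenvalue n))"
  using spectrum_subset eigenvalue_in_spectrum eigenfunction_is_eigenfunction
  unfolding point_spectrum_def by blast+

end

theorem theorem3p9:
  fixes \<alpha> \<beta> \<phi> \<psi> \<theta> :: real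
  assumes "1 < \<alpha>" and "\<alpha> < \<beta>"
  defines "M \<equiv> lebesgue_on (two_intervals \<alpha> \<beta>)"
    and "P\<^sub>B \<equiv> momentum_restriction \<alpha> \<beta> (boundary_matrix 0 \<phi> \<psi> \<theta>)"
    and "\<Lambda> \<equiv> range (\<lambda>n::int. complex_of_real
               ((1/2 - \<theta>) / (1 + \<beta> - \<alpha>) + 1 / (1 + \<beta> - \<alpha>) * of_int n))"
  shows "has_pure_point_spectrum M P\<^sub>B \<Lambda> \<and>
         (\<forall>z\<in>\<Lambda>. has_eigenvalue_multiplicity M P\<^sub>B z 1) \<and>
         (\<forall>n::int. is_eigenfunction M P\<^sub>B
           (complex_of_real ((1/2 - \<theta> + of_int n) / (1 + \<beta> - \<alpha>)))
           (\<lambda>x. (e_fun (1/2 - \<psi> + ((1/2 + of_int n) * \<beta> + (1 - \<alpha>) * \<theta>) / (1 + \<beta> - \<alpha>))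
                    * indicator {0..1} x + indicator {\<alpha>..\<beta>} x)
                * e_fun ((1/2 - \<theta> + of_int n) / (1 + \<beta> - \<alpha>) * x)))"
proof -
  interpret T: two_intervals_momentum \<alpha> \<beta> \<phi> \<psi> \<theta>
    using assms(1,2) by unfold_locales
  have \<Lambda>: "\<Lambda> = range (\<lambda>n. of_real (T.eigenvalue n))"
    by (simp add: \<Lambda>_def T.eigenvalue_def add_divide_distrib)
  have "has_pure_point_spectrum M P\<^sub>B \<Lambda>"
    unfolding has_pure_point_spectrum_def \<Lambda> M_def P\<^sub>B_def
    using T.spectrum_eq T.eigenfunctions_total_P\<^sub>B by simp
  moreover have "\<forall>z\<in>\<Lambda>. has_eigenvalue_multiplicity M P\<^sub>B z 1"
    unfolding \<Lambda> M_def P\<^sub>B_def using T.eigenspace_one_dimensional by blast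
  moreover have "is_eigenfunction M P\<^sub>B (of_real (T.eigenvalue n)) (T.eigenfunction n)" for n
    unfolding M_def P\<^sub>B_def by (rule T.eigenfunction_is_eigenfunction)
  ultimately show ?thesis
    unfolding T.eigenfunction_def T.phase_def T.eigenvalue_def by blast
qed

end
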